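(* Let $\rho$ be a bipartite state on a finite-dimensional space $A\otimes B$. If $E_W(\rho)<E_\eta(\rho)$, then $$E_D(\rho)<E_C(\rho),$$ where $E_D$ and $E_C$ are the distillable entanglement and the entanglement cost under PPT operations.
   Context: All Hilbert spaces are finite-dimensional and $\log=\log_2$. A state is a positive semidefinite operator of trace one. $T_B$ denotes partial transpose on Bob's system: $(|i_Aj_B\rangle\langle k_Al_B|)^{T_B}=|i_Al_B\rangle\langle k_Aj_B|$. For tensor powers, the bipartition is all of Alice's systems versus all of Bob's systems. $\|\cdot\|_1$ is the trace norm and $\|\cdot\|_\infty$ the operator norm. With $P$ the orthogonal projection onto the support of $\rho$, $$E_\eta(\rho)=\max\{-\log\|Y^{T_B}\|_\infty:\ Y \text{ Hermitian on }A\otimes B,\ -Y\le P^{T_B}\le Y\},$$ $$E_W(\rho)=\min\{\log\|X^{T_B}\|_1:\ X \text{ Hermitian on }A\otimes B,\ X\ge\rho\}.$$ PPT operations: a CPTP map $\Lambda:\mathcal{L}(A\otimes B)\to\mathcal{L}(A'\otimes B')$ is a PPT operation if $T_{B'}\circ\Lambda\circ T_B$ is completely positive. Let $\Phi=|\phi\rangle\langle\phi|$, $|\phi\rangle=\frac1{\sqrt2}(|00\rangle+|11\rangle)$. Then $$E_D(\rho)=\sup\Big\{r\ge0:\lim_{n\to\infty}\inf_{\Lambda\text{ PPT operation}}\|\Lambda(\rho^{\otimes n})-\Phi^{\otimes\lfloor rn\rfloor}\|_1=0\Big\},$$ $$E_C(\rho)=\inf\Big\{r\ge0:\lim_{n\to\infty}\inf_{\Lambda\text{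 PPT operation}}\|\rho^{\otimes n}-\Lambda(\Phi^{\otimes\lfloor rn\rfloor})\|_1=0\Big\}.$$ *)

theory Defs
  imports
    Complex_Main
    "HOL-Library.Multiset"
    "HOL-Library.Extended_Real"
    "HOL-Computational_Algebra.Polynomial"
    "Jordan_Normal_Form.Char_Poly"
    "Jordan_Normal_Form.Schur_Decomposition"
    "Jordan_Normal_Form.Matrix_Kernel"
begin

text \<open>
  Operators on a \<open>d\<close>-dimensional Hilbert space are complex \<open>d\<close> by \<open>d\<close> matrices.  A bipartite space
  \<open>A \<otimes> B\<close> with \<open>dim A = a\<close>, \<open>dim B = b\<close> has dimension \<open>a * b\<close>; the product basis vector
  \<open>|i j>\<close> (\<open>i < a\<close>, \<open>j < b\<close>) has index \<open>i * b + j\<close>.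
\<close>

definition hermitian_mat :: "complex mat \<Rightarrow> bool" where
  "hermitian_mat M \<longleftrightarrow> square_mat M \<and> mat_adjoint M = M"

definition psd :: "complex mat \<Rightarrow> bool" where
  "psd M \<longleftrightarrow> hermitian_mat M \<and> (\<forall>v \<in> carrier_vec (dim_row M). 0 \<le> Re ((M *\<^sub>v v) \<bullet>c v))"

definition loewner_le :: "complex mat \<Rightarrow> complex mat \<Rightarrow> bool" where
  "loewner_le M N \<longleftrightarrow> psd (N - M)"

definition mtrace :: "complex mat \<Rightarrow> complex" where
  "mtrace M = (\<Sum>i < dim_row M. M $$ (i, i))"

definition vnorm :: "complex vec \<Rightarrow> real" where
  "vnorm v = sqrt (Re (v \<bullet>c v))"

definition op_norm :: "complex mat \<Rightarrow> real" where
  "op_norm M = (SUP v \<in> {v \<in> carrier_vec (dim_col M). vnorm v = 1}. vnorm (M *\<^sub>v v))"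

text \<open>The singular values are the square roots of the eigenvalues of \<open>M\<^sup>* M\<close>, counted with algebraic
  multiplicity; those eigenvalues are nonnegative reals, so \<open>Re\<close> only changes the type.  Their sum
  is the trace of the positive square root of \<open>M\<^sup>* M\<close>.\<close>

definition singular_values :: "complex mat \<Rightarrow> real multiset" where
  "singular_values M = image_mset (\<lambda>z. sqrt (Re z)) (proots (char_poly (mat_adjoint M * M)))"

definition trace_norm :: "complex mat \<Rightarrow> real" where
  "trace_norm M = sum_mset (singular_values M)"

definition state :: "nat \<Rightarrow> complex mat \<Rightarrow> bool" where
  "state d \<rho> \<longleftrightarrow> \<rho> \<in> carrier_mat d d \<and> psd \<rho> \<and> mtrace \<rho> = 1"

text \<open>Support: the orthogonal complement of the kernel.\<close>

definition support :: "complex mat \<Rightarrow> complex vec set" where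
  "support M = {v \<in> carrier_vec (dim_col M). \<forall>w \<in> mat_kernel M. v \<bullet>c w = 0}"

definition support_proj :: "complex mat \<Rightarrow> complex mat" where
  "support_proj M = (THE P. P \<in> carrier_mat (dim_col M) (dim_col M) \<and> hermitian_mat P \<and> P * P = P \<and>
     (\<lambda>v. P *\<^sub>v v) ` carrier_vec (dim_col M) = support M)"

text \<open>Partial transpose on the second factor, of dimension \<open>b\<close>: the entry in row \<open>(i, j)\<close> and column
  \<open>(k, l)\<close> is that of \<open>M\<close> in row \<open>(i, l)\<close> and column \<open>(k, j)\<close>.\<close>

definition partial_transpose :: "nat \<Rightarrow> complex mat \<Rightarrow> complex mat" where
  "partial_transpose b M = mat (dim_row M) (dim_col M)
     (\<lambda>(r, c). M $$ ((r div b) * b + c mod b, (c div b) * b + r mod b))"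

text \<open>Tensor product of an operator on \<open>A \<otimes> B\<close> (dimensions \<open>a\<close>, \<open>b\<close>) with one on \<open>A' \<otimes> B'\<close>
  (dimensions \<open>a'\<close>, \<open>b'\<close>), as an operator on \<open>(A \<otimes> A') \<otimes> (B \<otimes> B')\<close>, i.e. regrouped so that all of
  Alice's systems precede all of Bob's.  In both parties' spaces the primed index is the least
  significant one.\<close>

definition bi_index :: "nat \<Rightarrow> nat \<Rightarrow> nat \<Rightarrow> nat \<Rightarrow> nat" where
  "bi_index b a' b' r = ((r div (b * b')) div a') * b + (r mod (b * b')) div b'"

definition bi_index' :: "nat \<Rightarrow> nat \<Rightarrow> nat \<Rightarrow> nat \<Rightarrow> nat" where
  "bi_index' b a' b' r = ((r div (b * b')) mod a') * b' + (r mod (b * b')) mod b'"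

definition bi_tensor :: "nat \<Rightarrow> nat \<Rightarrow> nat \<Rightarrow> nat \<Rightarrow> complex mat \<Rightarrow> complex mat \<Rightarrow> complex mat" where
  "bi_tensor a b a' b' M N = mat ((a * a') * (b * b')) ((a * a') * (b * b'))
     (\<lambda>(r, c). M $$ (bi_index b a' b' r, bi_index b a' b' c)
             * N $$ (bi_index' b a' b' r, bi_index' b a' b' c))"

fun bi_power :: "nat \<Rightarrow> nat \<Rightarrow> complex mat \<Rightarrow> nat \<Rightarrow> complex mat" where
  "bi_power a b M 0 = 1\<^sub>m 1"
| "bi_power a b M (Suc n) = bi_tensor (a ^ n) (b ^ n) a b (bi_power a b M n) M"

definition linear_map :: "nat \<Rightarrow> nat \<Rightarrow> (complex mat \<Rightarrow> complex mat) \<Rightarrow> bool" where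
  "linear_map d d' L \<longleftrightarrow>
     (\<forall>M \<in> carrier_mat d d. L M \<in> carrier_mat d' d') \<and>
     (\<forall>M \<in> carrier_mat d d. \<forall>N \<in> carrier_mat d d. L (M + N) = L M + L N) \<and>
     (\<forall>z. \<forall>M \<in> carrier_mat d d. L (z \<cdot>\<^sub>m M) = z \<cdot>\<^sub>m L M)"

text \<open>\<open>ampliation k d d' L\<close> is \<open>id \<otimes> L\<close> with \<open>id\<close> on \<open>k\<close> by \<open>k\<close> matrices: it applies \<open>L\<close> to each
  of the \<open>k\<^sup>2\<close> blocks of size \<open>d\<close> by \<open>d\<close>.\<close>

definition block :: "nat \<Rightarrow> complex mat \<Rightarrow> nat \<Rightarrow> nat \<Rightarrow> complex mat" where
  "block d M p q = mat d d (\<lambda>(i, j). M $$ (p * d + i, q * d + j))"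

definition ampliation ::
    "nat \<Rightarrow> nat \<Rightarrow> nat \<Rightarrow> (complex mat \<Rightarrow> complex mat) \<Rightarrow> complex mat \<Rightarrow> complex mat" where
  "ampliation k d d' L M = mat (k * d') (k * d')
     (\<lambda>(r, c). L (block d M (r div d') (c div d')) $$ (r mod d', c mod d'))"

definition completely_positive :: "nat \<Rightarrow> nat \<Rightarrow> (complex mat \<Rightarrow> complex mat) \<Rightarrow> bool" where
  "completely_positive d d' L \<longleftrightarrow> linear_map d d' L \<and>
     (\<forall>k. \<forall>M \<in> carrier_mat (k * d) (k * d). psd M \<longrightarrow> psd (ampliation k d d' L M))"

definition trace_preserving :: "nat \<Rightarrow> (complex mat \<Rightarrow> complex mat) \<Rightarrow> bool" where
  "trace_preserving d L \<longleftrightarrow> (\<forall>M \<in> carrier_mat d d. mtrace (L M) = mtrace M)"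

definition ppt_operation ::
    "nat \<Rightarrow> nat \<Rightarrow> nat \<Rightarrow> nat \<Rightarrow> (complex mat \<Rightarrow> complex mat) \<Rightarrow> bool" where
  "ppt_operation a b a' b' L \<longleftrightarrow>
     completely_positive (a * b) (a' * b') L \<and> trace_preserving (a * b) L \<and>
     completely_positive (a * b) (a' * b') (partial_transpose b' \<circ> L \<circ> partial_transpose b)"

definition bell_vec :: "complex vec" where
  "bell_vec = vec_of_list [1 / sqrt 2, 0, 0, 1 / sqrt 2]"

definition bell_state :: "complex mat" where
  "bell_state = mat 4 4 (\<lambda>(r, c). bell_vec $ r * cnj (bell_vec $ c))"

text \<open>All extrema below are taken in the extended reals, so that they are the genuine suprema and
  infima without side conditions on boundedness or nonemptiness.  For a state the extrema in
  \<open>E_eta\<close> and \<open>E_W\<close> are finite and attained, and the arguments of the logarithms are positive.\<close>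

definition E_eta :: "nat \<Rightarrow> nat \<Rightarrow> complex mat \<Rightarrow> ereal" where
  "E_eta a b \<rho> =
     (SUP Y \<in> {Y \<in> carrier_mat (a * b) (a * b). hermitian_mat Y \<and>
                 loewner_le (- Y) (partial_transpose b (support_proj \<rho>)) \<and>
                 loewner_le (partial_transpose b (support_proj \<rho>)) Y}.
        ereal (- log 2 (op_norm (partial_transpose b Y))))"

definition E_W :: "nat \<Rightarrow> nat \<Rightarrow> complex mat \<Rightarrow> ereal" where
  "E_W a b \<rho> =
     (INF X \<in> {X \<in> carrier_mat (a * b) (a * b). hermitian_mat X \<and> loewner_le \<rho> X}.
        ereal (log 2 (trace_norm (partial_transpose b X))))"

definition distill_error :: "nat \<Rightarrow> nat \<Rightarrow> complex mat \<Rightarrow> nat \<Rightarrow> nat \<Rightarrow> ereal" where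
  "distill_error a b \<rho> n m =
     (INF L \<in> {L. ppt_operation (a ^ n) (b ^ n) (2 ^ m) (2 ^ m) L}.
        ereal (trace_norm (L (bi_power a b \<rho> n) - bi_power 2 2 bell_state m)))"

definition dilution_error :: "nat \<Rightarrow> nat \<Rightarrow> complex mat \<Rightarrow> nat \<Rightarrow> nat \<Rightarrow> ereal" where
  "dilution_error a b \<rho> n m =
     (INF L \<in> {L. ppt_operation (2 ^ m) (2 ^ m) (a ^ n) (b ^ n) L}.
        ereal (trace_norm (bi_power a b \<rho> n - L (bi_power 2 2 bell_state m))))"

definition E_D :: "nat \<Rightarrow> nat \<Rightarrow> complex mat \<Rightarrow> ereal" where
  "E_D a b \<rho> =
     (SUP r \<in> {r::real. 0 \<le> r \<and>
                 (\<lambda>n. distill_error a b \<rho> n (nat \<lfloor>r * real n\<rfloor>)) \<longlonglongrightarrow> 0}. ereal r)"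

definition E_C :: "nat \<Rightarrow> nat \<Rightarrow> complex mat \<Rightarrow> ereal" where
  "E_C a b \<rho> =
     (INF r \<in> {r::real. 0 \<le> r \<and>
                 (\<lambda>n. dilution_error a b \<rho> n (nat \<lfloor>r * real n\<rfloor>)) \<longlonglongrightarrow> 0}. ereal r)"

end

(* Call R dominating H when R - H and R + H are both positive semidefinite. Polarisation shows
   that domination passes to tensor products and that tr(HK) <= tr(RS) whenever R dominates H and
   S dominates K; positive maps preserve it. It replaces the multiplicativity of the trace norm
   and of the operator norm: a Hermitian H is dominated by |H|, of trace |H|_1, and by |H|_oo times
   the identity, and the partial transpose of the Bell state is dominated by half the identity.

   If X >= rho and a PPT operation L takes the n-fold power of rho to within eps of Phi^m, then
   1 - eps <= tr(Phi^m L(X^n)). Transposing Bob's side of both factors bounds this by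
   2^(-m) |X^T|_1^n, so every distillation rate is at most log |X^T|_1. If instead L takes Phi^m to
   within eps of the n-fold power of rho, then 1 - eps <= tr(P^n L(Phi^m)) for the support
   projection P of rho. When Y dominates P^T, two partial transpositions bound this by
   2^m |Y^T|_oo^n, so every dilution rate is at least -log |Y^T|_oo.
   Hence E_D <= E_W and E_eta <= E_C. *)

theory Submission
  imports Defs
begin

section \<open>The spectral theorem\<close>

text \<open>The partial transpose of a positive matrix is in general indefinite, and for indefinite
  factors a one-sided inequality does not pass to tensor products; a bound from both sides by one
  positive matrix does. The PPT condition enters by transposing Bob's side of both factors of a
  trace pairing: the value is unchanged, while the map is replaced by the transposed one, which is
  again positive. The gain lies in the Bell state: as a projection, its m-th power is dominated by
  the identity, but the transpose of that power already by 2^(-m) times the identity. In dilution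
  this identity is fed into a trace-preserving map and costs trace 4^m, hence a factor 2^m instead
  of 2^(-m). The spectral theorem comes first because it supplies everything concrete: the Gram form
  of positive matrices, the absolute value behind the trace norm, the eigenvectors that test the
  operator norm, and the support projection. For the rates it is enough that the errors are
  eventually below 1/2: then a positive constant bounds the n-th power of a fixed ratio from below
  for all large n, so this ratio is at least 1.\<close>

lemma mat_adjoint_dim [simp]:
  "dim_row (mat_adjoint A) = dim_col A" "dim_col (mat_adjoint A) = dim_row A"
  by (simp_all add: mat_adjoint_def)

lemma mat_adjoint_carrier [simp]: "A \<in> carrier_mat n m \<Longrightarrow> mat_adjoint A \<in> carrier_mat m n"
  by (rule carrier_matI) auto

lemma mat_adjoint_index [simp]:
  fixes A :: "complex mat"
  assumes "i < dim_col A" "j < dim_row A"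
  shows "mat_adjoint A $$ (i, j) = cnj (A $$ (j, i))"
  using assms by (simp add: mat_adjoint_def mat_of_rows_index)

lemma mult_mat_index:
  assumes "A \<in> carrier_mat n m" "B \<in> carrier_mat m k" "i < n" "j < k"
  shows "(A * B) $$ (i, j) = (\<Sum>l<m. A $$ (i, l) * B $$ (l, j))"
  using assms by (simp add: scalar_prod_def lessThan_atLeast0)

lemma mult_mat_vec_index:
  assumes "A \<in> carrier_mat n m" "v \<in> carrier_vec m" "i < n"
  shows "(A *\<^sub>v v) $ i = (\<Sum>l<m. A $$ (i, l) * v $ l)"
  using assms by (simp add: scalar_prod_def lessThan_atLeast0)

lemma mat_adjoint_mult:
  fixes A B :: "complex mat"
  assumes A: "A \<in> carrier_mat n m" and B: "B \<in> carrier_mat m k"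
  shows "mat_adjoint (A * B) = mat_adjoint B * mat_adjoint A"
proof (rule eq_matI)
  fix i j assume "i < dim_row (mat_adjoint B * mat_adjoint A)" "j < dim_col (mat_adjoint B * mat_adjoint A)"
  hence ij: "i < k" "j < n" using A B by auto
  have "mat_adjoint (A * B) $$ (i, j) = cnj ((A * B) $$ (j, i))" using A B ij by (intro mat_adjoint_index) auto
  also have "\<dots> = (\<Sum>l<m. cnj (A $$ (j, l)) * cnj (B $$ (l, i)))"
    using mult_mat_index[OF A B ij(2,1)] by (simp add: cnj_sum)
  also have "\<dots> = (\<Sum>l<m. mat_adjoint B $$ (i, l) * mat_adjoint A $$ (l, j))"
    by (intro sum.cong) (use A B ij in \<open>auto simp: mult.commute\<close>)
  also have "\<dots> = (mat_adjoint B * mat_adjoint A) $$ (i, j)"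
    by (subst mult_mat_index[of _ k m _ n]) (use A B ij in auto)
  finally show "mat_adjoint (A * B) $$ (i, j) = (mat_adjoint B * mat_adjoint A) $$ (i, j)" .
qed (use A B in auto)

lemma hermitian_mat_iff:
  assumes "A \<in> carrier_mat n n"
  shows "hermitian_mat A \<longleftrightarrow> (\<forall>i<n. \<forall>j<n. A $$ (j, i) = cnj (A $$ (i, j)))"
proof
  assume h: "hermitian_mat A"
  show "\<forall>i<n. \<forall>j<n. A $$ (j, i) = cnj (A $$ (i, j))"
  proof (intro allI impI)
    fix i j assume "i < n" "j < n"
    hence "mat_adjoint A $$ (j, i) = cnj (A $$ (i, j))" using assms by simp
    moreover have "mat_adjoint A = A" using h by (simp add: hermitian_mat_def)
    ultimately show "A $$ (j, i) = cnj (A $$ (i, j))" by metis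
  qed
next
  assume h: "\<forall>i<n. \<forall>j<n. A $$ (j, i) = cnj (A $$ (i, j))"
  have "mat_adjoint A = A"
  proof (rule eq_matI)
    fix i j assume "i < dim_row A" "j < dim_col A"
    hence ij: "i < n" "j < n" using assms by auto
    hence "A $$ (i, j) = cnj (A $$ (j, i))" using h by blast
    thus "mat_adjoint A $$ (i, j) = A $$ (i, j)" using assms ij by simp
  qed (use assms in auto)
  thus "hermitian_mat A" using assms by (simp add: hermitian_mat_def)
qed

section \<open>Unitary matrices and diagonalisation\<close>

definition unitary_mat :: "nat \<Rightarrow> complex mat \<Rightarrow> bool" where
  "unitary_mat n U \<longleftrightarrow> U \<in> carrier_mat n n \<and> U * mat_adjoint U = 1\<^sub>m n \<and> mat_adjoint U * U = 1\<^sub>m n"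

definition real_diag :: "nat \<Rightarrow> (nat \<Rightarrow> real) \<Rightarrow> complex mat" where
  "real_diag n d = mat n n (\<lambda>(i, j). if i = j then of_real (d i) else 0)"

lemma real_diag_carrier [simp]: "real_diag n d \<in> carrier_mat n n"
  by (simp add: real_diag_def)

lemma unitary_mat_mult:
  assumes "unitary_mat n U" "unitary_mat n V"
  shows "unitary_mat n (U * V)"
proof -
  have U: "U \<in> carrier_mat n n" "U * mat_adjoint U = 1\<^sub>m n" "mat_adjoint U * U = 1\<^sub>m n"
   and V: "V \<in> carrier_mat n n" "V * mat_adjoint V = 1\<^sub>m n" "mat_adjoint V * V = 1\<^sub>m n"
    using assms by (auto simp: unitary_mat_def)
  have aU: "mat_adjoint U \<in> carrier_mat n n" and aV: "mat_adjoint V \<in> carrier_mat n n" using U(1) V(1) by simp_all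
  have 1: "U * V * (mat_adjoint V * mat_adjoint U) = 1\<^sub>m n"
    unfolding assoc_mult_mat[OF U(1) V(1) mult_carrier_mat[OF aV aU]]
      assoc_mult_mat[OF V(1) aV aU, symmetric] V(2) left_mult_one_mat[OF aU] by (rule U(2))
  have 2: "mat_adjoint V * mat_adjoint U * (U * V) = 1\<^sub>m n"
    unfolding assoc_mult_mat[OF aV aU mult_carrier_mat[OF U(1) V(1)]]
      assoc_mult_mat[OF aU U(1) V(1), symmetric] U(3) left_mult_one_mat[OF V(1)] by (rule V(3))
  show ?thesis using 1 2 U(1) V(1) mat_adjoint_mult[OF U(1) V(1)] by (simp add: unitary_mat_def)
qed

lemma unitary_mat_self_inverse:
  "W \<in> carrier_mat n n \<Longrightarrow> mat_adjoint W = W \<Longrightarrow> W * W = 1\<^sub>m n \<Longrightarrow> unitary_mat n W"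
  by (simp add: unitary_mat_def)

text \<open>A reflection is its own inverse and its own adjoint, so a single matrix both completes
  \<open>v\<close> to an orthonormal basis and conjugates back. The first diagonal entry of a
  Hermitian \<open>W\<close> is real, which forces the condition on \<open>v $ 0\<close>.\<close>

lemma householder_exists:
  fixes v :: "complex vec"
  assumes v: "v \<in> carrier_vec (Suc n)" and real: "Im (v $ 0) = 0"
    and unit: "(\<Sum>i<Suc n. v $ i * cnj (v $ i)) = 1"
  shows "\<exists>W \<in> carrier_mat (Suc n) (Suc n). mat_adjoint W = W \<and> W * W = 1\<^sub>m (Suc n) \<and> col W 0 = v"
proof -
  define e :: "nat \<Rightarrow> complex" where "e i = (if i = 0 then 1 else 0)" for i
  define u where "u i = v $ i - e i" for i
  define x where "x = Re (v $ 0)"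
  have v0: "v $ 0 = of_real x" using real by (simp add: x_def complex_eq_iff)
  define c :: complex where "c = of_real (1 / (1 - x))"
  \<comment> \<open>Householder reflection along \<open>u = v - e\<close>; the division by zero in \<open>c\<close> when \<open>v = e\<close> is harmless, as then \<open>u = 0\<close>.\<close>
  define W where "W = mat (Suc n) (Suc n) (\<lambda>(i, j). (if i = j then 1 else 0) - c * u i * cnj (u j))"
  have Wc: "W \<in> carrier_mat (Suc n) (Suc n)" by (simp add: W_def)
  have u2: "(\<Sum>i<Suc n. u i * cnj (u i)) = of_real (2 - 2 * x)"
  proof -
    have "(\<Sum>i<Suc n. u i * cnj (u i)) =
      (\<Sum>i<Suc n. v $ i * cnj (v $ i) - (if i = 0 then v $ 0 + cnj (v $ 0) - 1 else 0))"
      by (rule sum.cong) (auto simp: u_def e_def algebra_simps)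
    also have "\<dots> = 1 - (v $ 0 + cnj (v $ 0) - 1)"
      by (simp add: sum_subtractf unit del: sum.lessThan_Suc)
    finally show ?thesis by (simp add: v0)
  qed
  \<comment> \<open>\<open>c\<close> is 2 / |u|^2, since |u|^2 = 2 - 2x; this identity makes the
    rank-one terms of \<open>W * W\<close> cancel. For x = 1 both sides are zero.\<close>
  have c2: "c * c * of_real (2 - 2 * x) = 2 * c"
  proof -
    have "1 / (1 - x) * (1 / (1 - x)) * (2 - 2 * x) = 2 * (1 / (1 - x))"
    proof (cases "x = 1")
      case False
      hence "1 - x \<noteq> 0" by simp
      define k where "k = 1 / (1 - x)"
      have "k * k * (2 - 2 * x) = 2 * k * (k * (1 - x))" by (simp add: algebra_simps)
      moreover have "k * (1 - x) = 1" using \<open>1 - x \<noteq> 0\<close> by (simp add: k_def)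
      ultimately show ?thesis by (simp add: k_def)
    qed simp
    thus ?thesis unfolding c_def by (metis of_real_mult of_real_numeral)
  qed
  have "hermitian_mat W" unfolding hermitian_mat_iff[OF Wc] by (simp add: W_def c_def)
  hence adj: "mat_adjoint W = W" by (simp add: hermitian_mat_def)
  have "W * W = 1\<^sub>m (Suc n)"
  proof (rule eq_matI)
    fix i j assume "i < dim_row (1\<^sub>m (Suc n) :: complex mat)" "j < dim_col (1\<^sub>m (Suc n) :: complex mat)"
    hence ij: "i < Suc n" "j < Suc n" by auto
    have "(W * W) $$ (i, j) = (\<Sum>l<Suc n. W $$ (i, l) * W $$ (l, j))" by (rule mult_mat_index[OF Wc Wc ij])
    also have "\<dots> = (\<Sum>l<Suc n. (if l = i then (if i = j then 1 else 0) - c * u i * cnj (u j) else 0)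
        - (if l = j then c * u i * cnj (u j) else 0) + c * c * u i * cnj (u j) * (u l * cnj (u l)))"
      by (rule sum.cong) (use ij in \<open>auto simp: W_def algebra_simps\<close>)
    also have "\<dots> = (if i = j then 1 else 0) - 2 * c * u i * cnj (u j)
        + c * c * u i * cnj (u j) * (\<Sum>l<Suc n. u l * cnj (u l))"
      using ij by (simp add: sum.distrib sum_subtractf sum_distrib_left[symmetric] del: sum.lessThan_Suc)
    also have "\<dots> = (if i = j then 1 else 0) - 2 * c * u i * cnj (u j)
        + (c * c * of_real (2 - 2 * x)) * u i * cnj (u j)" unfolding u2 by simp
    also have "\<dots> = (if i = j then 1 else 0)" unfolding c2 by simp
    finally show "(W * W) $$ (i, j) = (1\<^sub>m (Suc n)) $$ (i, j)" using ij by simp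
  qed (use Wc in auto)
  moreover have "col W 0 = v"
  proof (rule eq_vecI)
    fix i assume "i < dim_vec v"
    hence i: "i < Suc n" using v by auto
    have *: "c * u i * of_real (1 - x) = u i"
    proof (cases "x = 1")
      case True
      hence "(\<Sum>i<Suc n. (cmod (u i))\<^sup>2) = 0"
        using u2 by (simp add: complex_norm_square[symmetric] flip: of_real_sum of_real_power of_real_add)
      hence "u i = 0" using i by (subst (asm) sum_nonneg_eq_0_iff) auto
      thus ?thesis by simp
    next
      case False
      hence "c * of_real (1 - x) = 1" unfolding c_def of_real_mult[symmetric] by simp
      thus ?thesis by (simp add: mult.commute mult.left_commute)
    qed
    have "col W 0 $ i = e i + c * u i * of_real (1 - x)"
      using i by (auto simp: W_def e_def u_def v0 algebra_simps)
    thus "col W 0 $ i = v $ i" unfolding * by (simp add: u_def)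
  qed (use v Wc in auto)
  ultimately show ?thesis using Wc adj by (intro bexI[of _ W] conjI)
qed

text \<open>A root of the characteristic polynomial gives an eigenvector, which is then scaled in
  length and phase to meet the hypotheses of \<open>householder_exists\<close>.\<close>

lemma unit_eigenvector_exists:
  fixes A :: "complex mat"
  assumes A: "A \<in> carrier_mat (Suc n) (Suc n)"
  shows "\<exists>k v. v \<in> carrier_vec (Suc n) \<and> Im (v $ 0) = 0 \<and> (\<Sum>i<Suc n. v $ i * cnj (v $ i)) = 1
    \<and> A *\<^sub>v v = k \<cdot>\<^sub>v v"
proof -
  have "degree (char_poly A) = Suc n" using degree_monic_char_poly[OF A] by simp
  hence "\<not> constant (poly (char_poly A))" by (simp add: constant_degree)
  then obtain k where "poly (char_poly A) k = 0" using fundamental_theorem_of_algebra by blast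
  hence "eigenvalue A k" using eigenvalue_root_char_poly[OF A] by simp
  then obtain w where w: "w \<in> carrier_vec (Suc n)" "w \<noteq> 0\<^sub>v (Suc n)" "A *\<^sub>v w = k \<cdot>\<^sub>v w"
    using A by (auto simp: eigenvalue_def eigenvector_def)
  define s where "s = (\<Sum>i<Suc n. (cmod (w $ i))\<^sup>2)"
  obtain i where i: "i < Suc n" "w $ i \<noteq> 0" using w(1,2) by (metis eq_vecI carrier_vecD index_zero_vec)
  have "s \<noteq> 0" unfolding s_def using i by (subst sum_nonneg_eq_0_iff) auto
  moreover have "0 \<le> s" unfolding s_def by (rule sum_nonneg) auto
  ultimately have s: "s > 0" by simp
  \<comment> \<open>This phase turns the first coordinate into its modulus; a zero coordinate stays
    real under any phase.\<close>
  define p where "p = (if w $ 0 = 0 then 1 else cnj (w $ 0) / of_real (cmod (w $ 0)))"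
  have p1: "cmod p = 1" by (simp add: p_def norm_divide)
  have p0: "Im (p * w $ 0) = 0"
    by (simp add: p_def mult.commute complex_mult_cnj flip: of_real_divide)
  define c where "c = p / of_real (sqrt s)"
  have "(\<Sum>i<Suc n. (c \<cdot>\<^sub>v w) $ i * cnj ((c \<cdot>\<^sub>v w) $ i)) = (\<Sum>i<Suc n. of_real ((cmod (w $ i))\<^sup>2 / s))"
  proof (rule sum.cong)
    fix i assume "i \<in> {..<Suc n}"
    hence "(c \<cdot>\<^sub>v w) $ i * cnj ((c \<cdot>\<^sub>v w) $ i) = of_real ((cmod (c * w $ i))\<^sup>2)"
      using w(1) complex_norm_square[of "c * w $ i"] by simp
    also have "(cmod (c * w $ i))\<^sup>2 = (cmod (w $ i))\<^sup>2 / s"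
      using s p1 by (simp add: c_def norm_mult norm_divide power_mult_distrib power_divide)
    finally show "(c \<cdot>\<^sub>v w) $ i * cnj ((c \<cdot>\<^sub>v w) $ i) = of_real ((cmod (w $ i))\<^sup>2 / s)" .
  qed simp
  also have "\<dots> = 1" using s unfolding of_real_sum[symmetric] sum_divide_distrib[symmetric] s_def[symmetric] by simp
  finally have "(\<Sum>i<Suc n. (c \<cdot>\<^sub>v w) $ i * cnj ((c \<cdot>\<^sub>v w) $ i)) = 1" .
  moreover have "Im ((c \<cdot>\<^sub>v w) $ 0) = 0"
    using p0 w(1) by (simp add: c_def)
  moreover have "A *\<^sub>v (c \<cdot>\<^sub>v w) = k \<cdot>\<^sub>v (c \<cdot>\<^sub>v w)"
    using mult_mat_vec[OF A w(1)] w(3) by (simp add: smult_smult_assoc mult.commute)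
  moreover have "c \<cdot>\<^sub>v w \<in> carrier_vec (Suc n)" using w(1) by simp
  ultimately show ?thesis by (intro exI[of _ k] exI[of _ "c \<cdot>\<^sub>v w"] conjI)
qed

lemma mat_adjoint_four_block:
  fixes A D :: "complex mat"
  assumes "A \<in> carrier_mat 1 1" "D \<in> carrier_mat n n"
  shows "mat_adjoint (four_block_mat A (0\<^sub>m 1 n) (0\<^sub>m n 1) D)
    = four_block_mat (mat_adjoint A) (0\<^sub>m 1 n) (0\<^sub>m n 1) (mat_adjoint D)"
  by (rule eq_matI) (use assms in auto)

lemma mult_four_block_diag:
  fixes A D :: "complex mat"
  assumes "A \<in> carrier_mat 1 1" "D \<in> carrier_mat n n" "A' \<in> carrier_mat 1 1" "D' \<in> carrier_mat n n"
  shows "four_block_mat A (0\<^sub>m 1 n) (0\<^sub>m n 1) D * four_block_mat A' (0\<^sub>m 1 n) (0\<^sub>m n 1) D'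
    = four_block_mat (A * A') (0\<^sub>m 1 n) (0\<^sub>m n 1) (D * D')"
  by (subst mult_four_block_mat[of _ 1 1 _ n _ n _ _ 1 _ n]) (use assms in simp_all)

text \<open>With \<open>U\<close> fixed and \<open>d\<close> varying this is a functional calculus:
  sums, products, absolute values and support projections arise by acting on \<open>d\<close>
  alone.\<close>

definition spectral_mat :: "nat \<Rightarrow> complex mat \<Rightarrow> (nat \<Rightarrow> real) \<Rightarrow> complex mat" where
  "spectral_mat n U d = U * real_diag n d * mat_adjoint U"

text \<open>Deflation. Reflecting the first basis vector to a unit eigenvector makes the first
  column of \<open>B\<close> a multiple of that basis vector; Hermitian symmetry does the same for
  the first row, and induction diagonalises the remaining block.\<close>

theorem spectral_theorem:
  assumes "A \<in> carrier_mat n n" "hermitian_mat A"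
  shows "\<exists>U d. unitary_mat n U \<and> A = spectral_mat n U d"
  using assms
proof (induction n arbitrary: A)
  case 0
  have "unitary_mat 0 (1\<^sub>m 0)" unfolding unitary_mat_def by (auto intro!: eq_matI)
  moreover have "A = spectral_mat 0 (1\<^sub>m 0) (\<lambda>_. 0)"
    by (rule eq_matI) (use 0 in \<open>auto simp: spectral_mat_def\<close>)
  ultimately show ?case by (intro exI conjI)
next
  case (Suc n)
  note A = Suc.prems(1)
  have adjA: "mat_adjoint A = A" using Suc.prems(2) by (simp add: hermitian_mat_def)
  obtain k v where v: "v \<in> carrier_vec (Suc n)" "Im (v $ 0) = 0"
      "(\<Sum>i<Suc n. v $ i * cnj (v $ i)) = 1" "A *\<^sub>v v = k \<cdot>\<^sub>v v"
    using unit_eigenvector_exists[OF A] by (elim exE conjE)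
  obtain W where W: "W \<in> carrier_mat (Suc n) (Suc n)" "mat_adjoint W = W" "W * W = 1\<^sub>m (Suc n)" "col W 0 = v"
    using householder_exists[OF v(1-3)] by (elim bexE conjE)
  define B where "B = W * (A * W)"
  have AW: "A * W \<in> carrier_mat (Suc n) (Suc n)" using A W(1) by (rule mult_carrier_mat)
  have B: "B \<in> carrier_mat (Suc n) (Suc n)" unfolding B_def using W(1) AW by (rule mult_carrier_mat)
  have "mat_adjoint B = B"
    unfolding B_def mat_adjoint_mult[OF W(1) AW] mat_adjoint_mult[OF A W(1)] adjA W(2)
    by (rule assoc_mult_mat[OF W(1) A W(1)])
  hence hB: "hermitian_mat B" using B by (simp add: hermitian_mat_def)
  have Bsym: "B $$ (j, i) = cnj (B $$ (i, j))" if "i < Suc n" "j < Suc n" for i j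
    using hB that unfolding hermitian_mat_iff[OF B] by blast
  have "col B 0 = W *\<^sub>v (A *\<^sub>v v)"
    unfolding B_def using col_mult2[OF W(1) AW, of 0] col_mult2[OF A W(1), of 0] W(4) by simp
  also have "\<dots> = k \<cdot>\<^sub>v (W *\<^sub>v v)" unfolding v(4) by (rule mult_mat_vec[OF W(1) v(1)])
  also have "W *\<^sub>v v = col (W * W) 0" using col_mult2[OF W(1) W(1), of 0] W(4) by simp
  finally have colB: "col B 0 = k \<cdot>\<^sub>v col (1\<^sub>m (Suc n)) 0" unfolding W(3) .
  have B0: "B $$ (i, 0) = (if i = 0 then k else 0)" if "i < Suc n" for i
    using arg_cong[OF colB, of "\<lambda>w. w $ i"] that B by auto
  have k: "cnj k = k" using Bsym[of 0 0] B0[of 0] by simp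
  have B0': "B $$ (0, i) = (if i = 0 then k else 0)" if "i < Suc n" for i
    using B0[OF that] Bsym[of i 0] that k by auto
  define A' where "A' = mat n n (\<lambda>(i, j). B $$ (Suc i, Suc j))"
  have A': "A' \<in> carrier_mat n n" by (simp add: A'_def)
  have hA': "hermitian_mat A'"
    unfolding hermitian_mat_iff[OF A']
  proof (intro allI impI)
    fix i j assume ij: "i < n" "j < n"
    have "B $$ (Suc j, Suc i) = cnj (B $$ (Suc i, Suc j))" by (rule Bsym) (use ij in auto)
    thus "A' $$ (j, i) = cnj (A' $$ (i, j))" using ij by (simp add: A'_def)
  qed
  obtain U' d' where U': "unitary_mat n U'" "A' = spectral_mat n U' d'"
    using Suc.IH[OF A' hA'] by (elim exE conjE)
  have U'c: "U' \<in> carrier_mat n n" and U'1: "U' * mat_adjoint U' = 1\<^sub>m n" "mat_adjoint U' * U' = 1\<^sub>m n"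
    using U'(1) by (auto simp: unitary_mat_def)
  define V where "V = four_block_mat (1\<^sub>m 1) (0\<^sub>m 1 n) (0\<^sub>m n 1) U'"
  define d where "d i = (case i of 0 \<Rightarrow> Re k | Suc j \<Rightarrow> d' j)" for i
  have Vc: "V \<in> carrier_mat (Suc n) (Suc n)" unfolding V_def using U'c by (intro carrier_matI) auto
  have aVc: "mat_adjoint V \<in> carrier_mat (Suc n) (Suc n)" using Vc by simp
  have one1: "mat_adjoint (1\<^sub>m 1 :: complex mat) = 1\<^sub>m 1" by (rule eq_matI) auto
  have aV: "mat_adjoint V = four_block_mat (1\<^sub>m 1) (0\<^sub>m 1 n) (0\<^sub>m n 1) (mat_adjoint U')"
    unfolding V_def by (subst mat_adjoint_four_block[OF _ U'c]) (auto simp: one1)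
  have aU'c: "mat_adjoint U' \<in> carrier_mat n n" using U'c by simp
  have one: "four_block_mat (1\<^sub>m 1) (0\<^sub>m 1 n) (0\<^sub>m n 1) (1\<^sub>m n) = (1\<^sub>m (Suc n) :: complex mat)"
    by (rule eq_matI) auto
  have uV: "unitary_mat (Suc n) V"
    unfolding unitary_mat_def
  proof (intro conjI)
    show "V * mat_adjoint V = 1\<^sub>m (Suc n)"
      unfolding aV unfolding V_def mult_four_block_diag[OF one_carrier_mat U'c one_carrier_mat aU'c] U'1
      using one by simp
    show "mat_adjoint V * V = 1\<^sub>m (Suc n)"
      unfolding aV unfolding V_def mult_four_block_diag[OF one_carrier_mat aU'c one_carrier_mat U'c] U'1
      using one by simp
  qed (rule Vc)
  have D: "real_diag (Suc n) d = four_block_mat (real_diag 1 (\<lambda>_. Re k)) (0\<^sub>m 1 n) (0\<^sub>m n 1) (real_diag n d')"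
    by (rule eq_matI) (auto simp: real_diag_def d_def split: nat.splits)
  have Bblk: "B = four_block_mat (real_diag 1 (\<lambda>_. Re k)) (0\<^sub>m 1 n) (0\<^sub>m n 1) A'"
  proof (rule eq_matI)
    have kk: "complex_of_real (Re k) = k" using k by (simp add: complex_eq_iff)
    fix i j assume "i < dim_row (four_block_mat (real_diag 1 (\<lambda>_. Re k)) (0\<^sub>m 1 n) (0\<^sub>m n 1) A')"
      "j < dim_col (four_block_mat (real_diag 1 (\<lambda>_. Re k)) (0\<^sub>m 1 n) (0\<^sub>m n 1) A')"
    hence ij: "i < Suc n" "j < Suc n" using A' by (auto simp: real_diag_def)
    show "B $$ (i, j) = four_block_mat (real_diag 1 (\<lambda>_. Re k)) (0\<^sub>m 1 n) (0\<^sub>m n 1) A' $$ (i, j)"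
      using ij B0[of i] B0'[of j] A' by (cases i; cases j) (auto simp: real_diag_def A'_def kk)
  qed (use B A' in \<open>auto simp: real_diag_def\<close>)
  have "V * real_diag (Suc n) d * mat_adjoint V = B"
  proof -
    have c1: "real_diag 1 (\<lambda>_. Re k) \<in> carrier_mat 1 1" "real_diag n d' \<in> carrier_mat n n" by simp_all
    show ?thesis
      unfolding aV D Bblk unfolding V_def mult_four_block_diag[OF one_carrier_mat U'c c1]
        left_mult_one_mat[OF c1(1)]
        mult_four_block_diag[OF c1(1) mult_carrier_mat[OF U'c c1(2)] one_carrier_mat aU'c]
        right_mult_one_mat[OF c1(1)]
      unfolding U'(2) spectral_mat_def ..
  qed
  note VB = this
  have A_eq: "A = W * (B * W)"
  proof -
    have WA: "W * A \<in> carrier_mat (Suc n) (Suc n)" using W(1) A by (rule mult_carrier_mat)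
    have "B * W = W * A * W * W" unfolding B_def assoc_mult_mat[OF W(1) A W(1)] ..
    also have "\<dots> = W * A * (W * W)" by (rule assoc_mult_mat[OF WA W(1) W(1)])
    also have "\<dots> = W * A" unfolding W(3) by (rule right_mult_one_mat[OF WA])
    finally have "W * (B * W) = W * W * A" using assoc_mult_mat[OF W(1) W(1) A] by simp
    thus ?thesis unfolding W(3) left_mult_one_mat[OF A] ..
  qed
  have WVc: "W * V \<in> carrier_mat (Suc n) (Suc n)" using W(1) Vc by (rule mult_carrier_mat)
  have Dc: "real_diag (Suc n) d \<in> carrier_mat (Suc n) (Suc n)" by simp
  have "spectral_mat (Suc n) (W * V) d = W * V * real_diag (Suc n) d * (mat_adjoint V * W)"
    unfolding spectral_mat_def mat_adjoint_mult[OF W(1) Vc] W(2) ..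
  also have "W * V * real_diag (Suc n) d = W * (V * real_diag (Suc n) d)"
    by (rule assoc_mult_mat[OF W(1) Vc Dc])
  also have "W * (V * real_diag (Suc n) d) * (mat_adjoint V * W)
      = W * (V * real_diag (Suc n) d * (mat_adjoint V * W))"
    by (rule assoc_mult_mat[OF W(1) mult_carrier_mat[OF Vc Dc] mult_carrier_mat[OF aVc W(1)]])
  also have "V * real_diag (Suc n) d * (mat_adjoint V * W) = B * W"
    unfolding VB[symmetric] by (rule assoc_mult_mat[OF mult_carrier_mat[OF Vc Dc] aVc W(1), symmetric])
  finally have "A = spectral_mat (Suc n) (W * V) d" using A_eq by simp
  moreover have "unitary_mat (Suc n) (W * V)"
    using unitary_mat_self_inverse[OF W(1-3)] uV by (rule unitary_mat_mult)
  ultimately show ?case by (intro exI conjI)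
qed

section \<open>Positive semidefinite matrices and domination\<close>

lemma sum_swap3:
  "(\<Sum>i\<in>A. \<Sum>j\<in>B. \<Sum>k\<in>C. g i j k) = (\<Sum>k\<in>C. \<Sum>i\<in>A. \<Sum>j\<in>B. (g i j k :: 'a::comm_monoid_add))"
proof -
  have "(\<Sum>i\<in>A. \<Sum>j\<in>B. \<Sum>k\<in>C. g i j k) = (\<Sum>i\<in>A. \<Sum>k\<in>C. \<Sum>j\<in>B. g i j k)"
    by (intro sum.cong refl sum.swap)
  also have "\<dots> = (\<Sum>k\<in>C. \<Sum>i\<in>A. \<Sum>j\<in>B. g i j k)" by (rule sum.swap)
  finally show ?thesis .
qed

lemma mult_real_diag_index:
  assumes "U \<in> carrier_mat n n" "i < n" "k < n"
  shows "(U * real_diag n d) $$ (i, k) = of_real (d k) * U $$ (i, k)"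
proof -
  have "(U * real_diag n d) $$ (i, k) = (\<Sum>l<n. U $$ (i, l) * real_diag n d $$ (l, k))"
    by (rule mult_mat_index[OF assms(1) real_diag_carrier assms(2,3)])
  also have "\<dots> = (\<Sum>l<n. if l = k then of_real (d k) * U $$ (i, k) else 0)"
    by (rule sum.cong) (use assms in \<open>auto simp: real_diag_def\<close>)
  finally show ?thesis using assms by simp
qed

lemma spectral_mat_carrier [simp]: "U \<in> carrier_mat n n \<Longrightarrow> spectral_mat n U d \<in> carrier_mat n n"
  unfolding spectral_mat_def by (intro mult_carrier_mat[of _ n n]) auto

lemma spectral_mat_index:
  assumes U: "U \<in> carrier_mat n n" and ij: "i < n" "j < n"
  shows "spectral_mat n U d $$ (i, j) = (\<Sum>k<n. of_real (d k) * (U $$ (i, k) * cnj (U $$ (j, k))))"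
proof -
  have "spectral_mat n U d $$ (i, j) = (\<Sum>k<n. (U * real_diag n d) $$ (i, k) * mat_adjoint U $$ (k, j))"
    unfolding spectral_mat_def using U ij
    by (intro mult_mat_index[of _ n n _ n] mult_carrier_mat[of _ n n]) auto
  also have "\<dots> = (\<Sum>k<n. of_real (d k) * (U $$ (i, k) * cnj (U $$ (j, k))))"
  proof (rule sum.cong)
    fix k assume "k \<in> {..<n}"
    hence k: "k < n" by simp
    have "mat_adjoint U $$ (k, j) = cnj (U $$ (j, k))" using U ij k by simp
    thus "(U * real_diag n d) $$ (i, k) * mat_adjoint U $$ (k, j)
        = of_real (d k) * (U $$ (i, k) * cnj (U $$ (j, k)))"
      using mult_real_diag_index[OF U ij(1) k] by simp
  qed simp
  finally show ?thesis .
qed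

lemma unitary_mat_cols:
  assumes "unitary_mat n U" "k < n" "l < n"
  shows "(\<Sum>i<n. cnj (U $$ (i, k)) * U $$ (i, l)) = (if k = l then 1 else 0)"
proof -
  have U: "U \<in> carrier_mat n n" "mat_adjoint U * U = 1\<^sub>m n" using assms(1) by (auto simp: unitary_mat_def)
  have "(\<Sum>i<n. cnj (U $$ (i, k)) * U $$ (i, l)) = (\<Sum>i<n. mat_adjoint U $$ (k, i) * U $$ (i, l))"
    by (rule sum.cong) (use U(1) assms(2,3) in auto)
  also have "\<dots> = (mat_adjoint U * U) $$ (k, l)"
    by (rule mult_mat_index[symmetric]) (use U(1) assms in auto)
  finally show ?thesis unfolding U(2) using assms by simp
qed

lemma unitary_mat_rows:
  assumes "unitary_mat n U" "i < n" "j < n"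
  shows "(\<Sum>k<n. U $$ (i, k) * cnj (U $$ (j, k))) = (if i = j then 1 else 0)"
proof -
  have U: "U \<in> carrier_mat n n" "U * mat_adjoint U = 1\<^sub>m n" using assms(1) by (auto simp: unitary_mat_def)
  have "(\<Sum>k<n. U $$ (i, k) * cnj (U $$ (j, k))) = (\<Sum>k<n. U $$ (i, k) * mat_adjoint U $$ (k, j))"
    by (rule sum.cong) (use U(1) assms(2,3) in auto)
  also have "\<dots> = (U * mat_adjoint U) $$ (i, j)"
    by (rule mult_mat_index[symmetric]) (use U(1) assms in auto)
  finally show ?thesis unfolding U(2) using assms by simp
qed

lemma spectral_mat_mult_unitary:
  assumes "unitary_mat n U"
  shows "spectral_mat n U d * U = U * real_diag n d"
proof -
  have U: "U \<in> carrier_mat n n" "mat_adjoint U * U = 1\<^sub>m n" using assms by (auto simp: unitary_mat_def)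
  have UD: "U * real_diag n d \<in> carrier_mat n n" using U(1) by (rule mult_carrier_mat) simp
  have "spectral_mat n U d * U = U * real_diag n d * (mat_adjoint U * U)"
    unfolding spectral_mat_def by (rule assoc_mult_mat[OF UD _ U(1)]) (simp add: U(1))
  thus ?thesis unfolding U(2) right_mult_one_mat[OF UD] .
qed

lemma spectral_mat_eigen:
  assumes "unitary_mat n U" "i < n" "k < n"
  shows "(\<Sum>j<n. spectral_mat n U d $$ (i, j) * U $$ (j, k)) = of_real (d k) * U $$ (i, k)"
proof -
  have U: "U \<in> carrier_mat n n" using assms by (auto simp: unitary_mat_def)
  have "(\<Sum>j<n. spectral_mat n U d $$ (i, j) * U $$ (j, k)) = (spectral_mat n U d * U) $$ (i, k)"
    by (rule mult_mat_index[symmetric]) (use U assms in auto)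
  thus ?thesis unfolding spectral_mat_mult_unitary[OF assms(1)] mult_real_diag_index[OF U assms(2,3)] .
qed

section \<open>Positive semidefinite matrices as Gram matrices\<close>

lemma cscalar_prod_index:
  fixes v w :: "complex vec"
  shows "w \<in> carrier_vec n \<Longrightarrow> v \<bullet>c w = (\<Sum>i<n. v $ i * cnj (w $ i))"
  by (simp add: scalar_prod_def lessThan_atLeast0)

text \<open>The test vector becomes an arbitrary function on indices, so the form can be evaluated
  at any coefficients without dimension side conditions.\<close>

lemma psd_iff_form:
  assumes M: "M \<in> carrier_mat n n"
  shows "psd M \<longleftrightarrow> hermitian_mat M \<and>
    (\<forall>x::nat \<Rightarrow> complex. 0 \<le> Re (\<Sum>i<n. \<Sum>j<n. M $$ (i, j) * x j * cnj (x i)))"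
proof -
  have form: "(M *\<^sub>v v) \<bullet>c v = (\<Sum>i<n. \<Sum>j<n. M $$ (i, j) * v $ j * cnj (v $ i))"
    if v: "v \<in> carrier_vec n" for v
    unfolding cscalar_prod_index[OF v] sum_distrib_right[symmetric]
    by (intro sum.cong arg_cong2[of _ _ _ _ "(*)"] refl mult_mat_vec_index[OF M v]) simp
  have "(\<forall>v \<in> carrier_vec n. 0 \<le> Re ((M *\<^sub>v v) \<bullet>c v)) \<longleftrightarrow>
    (\<forall>x::nat \<Rightarrow> complex. 0 \<le> Re (\<Sum>i<n. \<Sum>j<n. M $$ (i, j) * x j * cnj (x i)))"
  proof
    assume h: "\<forall>v \<in> carrier_vec n. 0 \<le> Re ((M *\<^sub>v v) \<bullet>c v)"
    show "\<forall>x::nat \<Rightarrow> complex. 0 \<le> Re (\<Sum>i<n. \<Sum>j<n. M $$ (i, j) * x j * cnj (x i))"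
    proof
      fix x :: "nat \<Rightarrow> complex"
      have v: "vec n x \<in> carrier_vec n" by simp
      have "(\<Sum>i<n. \<Sum>j<n. M $$ (i, j) * x j * cnj (x i)) = (M *\<^sub>v vec n x) \<bullet>c vec n x"
        unfolding form[OF v] by (intro sum.cong refl) auto
      thus "0 \<le> Re (\<Sum>i<n. \<Sum>j<n. M $$ (i, j) * x j * cnj (x i))" using h v by simp
    qed
  qed (use form in auto)
  thus ?thesis using M by (auto simp: psd_def)
qed

text \<open>A Gram representation certifies positivity: the quadratic form becomes the sum of |z
  k|^2 over \<open>K\<close>.\<close>

lemma psd_gramI:
  assumes M: "M \<in> carrier_mat n n"
    and gram: "\<And>i j. i < n \<Longrightarrow> j < n \<Longrightarrow> M $$ (i, j) = (\<Sum>k\<in>K. f k i * cnj (f k j))"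
  shows "psd M"
  unfolding psd_iff_form[OF M] hermitian_mat_iff[OF M]
proof (intro conjI allI impI)
  fix i j assume "i < n" "j < n"
  thus "M $$ (j, i) = cnj (M $$ (i, j))" by (simp add: gram cnj_sum mult.commute)
next
  fix x :: "nat \<Rightarrow> complex"
  define z where "z k = (\<Sum>i<n. f k i * cnj (x i))" for k
  have "(\<Sum>i<n. \<Sum>j<n. M $$ (i, j) * x j * cnj (x i))
      = (\<Sum>i<n. \<Sum>j<n. \<Sum>k\<in>K. (f k i * cnj (x i)) * cnj (f k j * cnj (x j)))"
    by (intro sum.cong refl) (simp add: gram sum_distrib_right sum_distrib_left mult_ac)
  also have "\<dots> = (\<Sum>k\<in>K. z k * cnj (z k))"
    unfolding z_def cnj_sum sum_product by (rule sum_swap3)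
  finally show "0 \<le> Re (\<Sum>i<n. \<Sum>j<n. M $$ (i, j) * x j * cnj (x i))"
    by (simp add: sum_nonneg)
qed

text \<open>The columns of \<open>U\<close>, scaled by the square roots of the eigenvalues, form the
  Gram family. In this form, positivity of tensor products and of trace pairings becomes a
  computation with sums.\<close>

lemma psd_gramE:
  assumes "psd M" "M \<in> carrier_mat n n"
  obtains f :: "nat \<Rightarrow> nat \<Rightarrow> complex"
  where "\<And>i j. i < n \<Longrightarrow> j < n \<Longrightarrow> M $$ (i, j) = (\<Sum>k<n. f k i * cnj (f k j))"
proof -
  have hM: "hermitian_mat M" using assms(1) by (simp add: psd_def)
  obtain U d where U: "unitary_mat n U" and Md: "M = spectral_mat n U d"
    using spectral_theorem[OF assms(2) hM] by (elim exE conjE)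
  have Uc: "U \<in> carrier_mat n n" using U by (simp add: unitary_mat_def)
  \<comment> \<open>Evaluating the quadratic form at the k-th column of \<open>U\<close> returns the
    k-th eigenvalue.\<close>
  have d: "0 \<le> d k" if k: "k < n" for k
  proof -
    have "(\<Sum>i<n. \<Sum>j<n. M $$ (i, j) * U $$ (j, k) * cnj (U $$ (i, k)))
        = (\<Sum>i<n. of_real (d k) * (cnj (U $$ (i, k)) * U $$ (i, k)))"
      unfolding sum_distrib_right[symmetric] Md
      by (intro sum.cong refl) (simp add: spectral_mat_eigen[OF U _ k])
    also have "\<dots> = of_real (d k)"
      unfolding sum_distrib_left[symmetric] unitary_mat_cols[OF U k k] by simp
    finally have "Re (\<Sum>i<n. \<Sum>j<n. M $$ (i, j) * U $$ (j, k) * cnj (U $$ (i, k))) = d k" by simp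
    moreover have "0 \<le> Re (\<Sum>i<n. \<Sum>j<n. M $$ (i, j) * U $$ (j, k) * cnj (U $$ (i, k)))"
      using assms(1) unfolding psd_iff_form[OF assms(2)] by (elim conjE allE[of _ "\<lambda>j. U $$ (j, k)"])
    ultimately show ?thesis by simp
  qed
  show thesis
  proof (rule that[of "\<lambda>k i. of_real (sqrt (d k)) * U $$ (i, k)"])
    fix i j assume ij: "i < n" "j < n"
    show "M $$ (i, j) = (\<Sum>k<n. of_real (sqrt (d k)) * U $$ (i, k) * cnj (of_real (sqrt (d k)) * U $$ (j, k)))"
      unfolding Md spectral_mat_index[OF Uc ij]
    proof (rule sum.cong)
      fix k assume "k \<in> {..<n}"
      hence "complex_of_real (d k) = of_real (sqrt (d k)) * of_real (sqrt (d k))"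
        using d[of k] by (simp flip: of_real_mult)
      thus "of_real (d k) * (U $$ (i, k) * cnj (U $$ (j, k)))
          = of_real (sqrt (d k)) * U $$ (i, k) * cnj (of_real (sqrt (d k)) * U $$ (j, k))" by simp
    qed simp
  qed
qed

lemma psd_spectral_mat:
  assumes U: "unitary_mat n U" and d: "\<And>k. k < n \<Longrightarrow> 0 \<le> d k"
  shows "psd (spectral_mat n U d)"
proof -
  have Uc: "U \<in> carrier_mat n n" using U by (simp add: unitary_mat_def)
  show ?thesis
  proof (rule psd_gramI[where K = "{..<n}" and f = "\<lambda>k i. of_real (sqrt (d k)) * U $$ (i, k)"])
    fix i j assume ij: "i < n" "j < n"
    show "spectral_mat n U d $$ (i, j)
      = (\<Sum>k<n. of_real (sqrt (d k)) * U $$ (i, k) * cnj (of_real (sqrt (d k)) * U $$ (j, k)))"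
      unfolding spectral_mat_index[OF Uc ij]
    proof (rule sum.cong)
      fix k assume "k \<in> {..<n}"
      hence "complex_of_real (d k) = of_real (sqrt (d k)) * of_real (sqrt (d k))"
        using d[of k] by (simp flip: of_real_mult)
      thus "of_real (d k) * (U $$ (i, k) * cnj (U $$ (j, k)))
          = of_real (sqrt (d k)) * U $$ (i, k) * cnj (of_real (sqrt (d k)) * U $$ (j, k))" by simp
    qed simp
  qed (use Uc in simp)
qed

lemma psd_add:
  assumes "psd M" "psd N" and M: "M \<in> carrier_mat n n" and N: "N \<in> carrier_mat n n"
  shows "psd (M + N)"
proof -
  have MN: "M + N \<in> carrier_mat n n" using M N by simp
  have e: "(M + N) $$ (i, j) = M $$ (i, j) + N $$ (i, j)" if "i < n" "j < n" for i j
    using M N that by simp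
  show ?thesis
    unfolding psd_iff_form[OF MN] hermitian_mat_iff[OF MN]
  proof (intro conjI allI impI)
    fix i j assume ij: "i < n" "j < n"
    have "M $$ (j, i) = cnj (M $$ (i, j))" "N $$ (j, i) = cnj (N $$ (i, j))"
      using assms(1,2) ij unfolding psd_iff_form[OF M] psd_iff_form[OF N] hermitian_mat_iff[OF M] hermitian_mat_iff[OF N]
      by blast+
    thus "(M + N) $$ (j, i) = cnj ((M + N) $$ (i, j))" using e ij by simp
  next
    fix x :: "nat \<Rightarrow> complex"
    have "(\<Sum>i<n. \<Sum>j<n. (M + N) $$ (i, j) * x j * cnj (x i))
      = (\<Sum>i<n. \<Sum>j<n. M $$ (i, j) * x j * cnj (x i)) + (\<Sum>i<n. \<Sum>j<n. N $$ (i, j) * x j * cnj (x i))"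
      unfolding sum.distrib[symmetric] by (intro sum.cong refl) (simp add: e algebra_simps)
    moreover have "0 \<le> Re (\<Sum>i<n. \<Sum>j<n. M $$ (i, j) * x j * cnj (x i))"
      "0 \<le> Re (\<Sum>i<n. \<Sum>j<n. N $$ (i, j) * x j * cnj (x i))"
      using assms(1,2) unfolding psd_iff_form[OF M] psd_iff_form[OF N] by blast+
    ultimately show "0 \<le> Re (\<Sum>i<n. \<Sum>j<n. (M + N) $$ (i, j) * x j * cnj (x i))" by simp
  qed
qed

lemma psd_smult:
  assumes "psd M" and M: "M \<in> carrier_mat n n" and c: "0 \<le> c"
  shows "psd (of_real c \<cdot>\<^sub>m M)"
proof -
  obtain f where f: "\<And>i j. i < n \<Longrightarrow> j < n \<Longrightarrow> M $$ (i, j) = (\<Sum>k<n. f k i * cnj (f k j))"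
    using psd_gramE[OF assms(1) M] by blast
  show ?thesis
  proof (rule psd_gramI[where K = "{..<n}" and f = "\<lambda>k i. of_real (sqrt c) * f k i"])
    fix i j assume ij: "i < n" "j < n"
    have "complex_of_real c = of_real (sqrt c) * of_real (sqrt c)" using c by (simp flip: of_real_mult)
    thus "(of_real c \<cdot>\<^sub>m M) $$ (i, j) = (\<Sum>k<n. of_real (sqrt c) * f k i * cnj (of_real (sqrt c) * f k j))"
      using ij M by (simp add: f sum_distrib_left mult_ac)
  qed (use M in simp)
qed

lemma psd_one: "psd (1\<^sub>m n)"
  by (rule psd_gramI[where n = n and K = "{..<n}" and f = "\<lambda>k i. if i = k then 1 else 0"])
    (auto simp: if_distrib cong: if_cong)

lemma psd_imp_hermitian: "psd M \<Longrightarrow> hermitian_mat M"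
  by (simp add: psd_def)

section \<open>The trace pairing and domination\<close>

text \<open>This is tr(MN), as \<open>hs_prod_eq_mtrace\<close> confirms. As a double sum over
  entries it is open to reindexing, which is how partial transposes and tensor products act on
  it.\<close>

definition hs_prod :: "nat \<Rightarrow> complex mat \<Rightarrow> complex mat \<Rightarrow> complex" where
  "hs_prod n M N = (\<Sum>i<n. \<Sum>j<n. M $$ (i, j) * N $$ (j, i))"

lemma hs_prod_commute: "hs_prod n M N = hs_prod n N M"
  unfolding hs_prod_def by (subst sum.swap) (simp add: mult.commute)

lemma hs_prod_one:
  assumes "M \<in> carrier_mat n n"
  shows "hs_prod n M (1\<^sub>m n) = mtrace M"
proof -
  have "hs_prod n M (1\<^sub>m n) = (\<Sum>i<n. \<Sum>j<n. if j = i then M $$ (i, i) else 0)"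
    unfolding hs_prod_def by (intro sum.cong refl) auto
  thus ?thesis using assms by (simp add: mtrace_def)
qed

lemma hs_prod_add:
  assumes "N \<in> carrier_mat n n" "N' \<in> carrier_mat n n"
  shows "hs_prod n M (N + N') = hs_prod n M N + hs_prod n M N'"
  unfolding hs_prod_def sum.distrib[symmetric]
  by (intro sum.cong refl) (use assms in \<open>simp add: algebra_simps\<close>)

lemma hs_prod_diff:
  assumes "N \<in> carrier_mat n n" "N' \<in> carrier_mat n n"
  shows "hs_prod n M (N - N') = hs_prod n M N - hs_prod n M N'"
  unfolding hs_prod_def sum_subtractf[symmetric]
  by (intro sum.cong refl) (use assms in \<open>simp add: algebra_simps\<close>)

lemma hs_prod_add_left:
  "M \<in> carrier_mat n n \<Longrightarrow> M' \<in> carrier_mat n n \<Longrightarrow> hs_prod n (M + M') N = hs_prod n M N + hs_prod n M' N"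
  by (simp only: hs_prod_commute[of n _ N] hs_prod_add)

lemma hs_prod_diff_left:
  "M \<in> carrier_mat n n \<Longrightarrow> M' \<in> carrier_mat n n \<Longrightarrow> hs_prod n (M - M') N = hs_prod n M N - hs_prod n M' N"
  by (simp only: hs_prod_commute[of n _ N] hs_prod_diff)

lemma hs_prod_smult:
  assumes "N \<in> carrier_mat n n"
  shows "hs_prod n M (c \<cdot>\<^sub>m N) = c * hs_prod n M N"
  unfolding hs_prod_def sum_distrib_left
  by (intro sum.cong refl) (use assms in \<open>simp add: mult_ac\<close>)

text \<open>A Gram representation of \<open>M\<close> turns the pairing into a sum of values of the
  quadratic form of \<open>N\<close>.\<close>

lemma hs_prod_psd_nonneg:
  assumes "psd M" "psd N" "M \<in> carrier_mat n n" "N \<in> carrier_mat n n"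
  shows "0 \<le> Re (hs_prod n M N)"
proof -
  obtain f where f: "\<And>i j. i < n \<Longrightarrow> j < n \<Longrightarrow> M $$ (i, j) = (\<Sum>k<n. f k i * cnj (f k j))"
    using psd_gramE[OF assms(1,3)] by blast
  have "hs_prod n N M = (\<Sum>i<n. \<Sum>j<n. \<Sum>k<n. N $$ (i, j) * f k j * cnj (f k i))"
    unfolding hs_prod_def by (intro sum.cong refl) (simp add: f sum_distrib_left mult_ac)
  also have "\<dots> = (\<Sum>k<n. \<Sum>i<n. \<Sum>j<n. N $$ (i, j) * f k j * cnj (f k i))" by (rule sum_swap3)
  finally have eq: "hs_prod n M N = (\<Sum>k<n. \<Sum>i<n. \<Sum>j<n. N $$ (i, j) * f k j * cnj (f k i))"
    unfolding hs_prod_commute[of n M] .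
  have "0 \<le> Re (\<Sum>i<n. \<Sum>j<n. N $$ (i, j) * f k j * cnj (f k i))" for k
    using assms(2) unfolding psd_iff_form[OF assms(4)] by blast
  thus ?thesis unfolding eq by (subst Re_sum) (rule sum_nonneg)
qed

text \<open>The order relation -R \<le> H \<le> R. It follows from |H| \<le> R but involves no
  square root, and it is insensitive to the sign of \<open>H\<close>, which makes it stable under
  products.\<close>

definition dominates :: "nat \<Rightarrow> complex mat \<Rightarrow> complex mat \<Rightarrow> bool" where
  "dominates n R H \<longleftrightarrow> R \<in> carrier_mat n n \<and> H \<in> carrier_mat n n \<and> psd (R - H) \<and> psd (R + H)"

lemma dominates_self:
  assumes "psd R" "R \<in> carrier_mat n n"
  shows "dominates n R R"
proof -
  \<comment> \<open>The zero matrix is the Gram matrix of the empty family.\<close>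
  have "psd (R - R)"
    by (rule psd_gramI[where n = n and K = "{}" and f = "\<lambda>_ _. 0"]) (use assms(2) in auto)
  thus ?thesis using assms psd_add[OF assms(1,1,2,2)] by (simp add: dominates_def)
qed

text \<open>Each of R + H and R - H pairs nonnegatively with each of S + K and S - K. The two
  pairings with opposite signs add up to 2 (tr RS - tr HK), the two with equal signs to 2 (tr RS +
  tr HK).\<close>

lemma hs_prod_dominates:
  assumes "dominates n R H" "dominates n S K"
  shows "\<bar>Re (hs_prod n H K)\<bar> \<le> Re (hs_prod n R S)"
proof -
  note R = assms(1)[unfolded dominates_def] and S = assms(2)[unfolded dominates_def]
  have Rc: "R \<in> carrier_mat n n" "H \<in> carrier_mat n n" "R - H \<in> carrier_mat n n" "R + H \<in> carrier_mat n n"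
    and Sc: "S \<in> carrier_mat n n" "K \<in> carrier_mat n n" "S - K \<in> carrier_mat n n" "S + K \<in> carrier_mat n n"
    using R S by (auto intro: minus_carrier_mat add_carrier_mat)
  have e: "Re (hs_prod n (R + H) (S + K)) = Re (hs_prod n R S) + Re (hs_prod n R K) + Re (hs_prod n H S) + Re (hs_prod n H K)"
    "Re (hs_prod n (R + H) (S - K)) = Re (hs_prod n R S) - Re (hs_prod n R K) + Re (hs_prod n H S) - Re (hs_prod n H K)"
    "Re (hs_prod n (R - H) (S + K)) = Re (hs_prod n R S) + Re (hs_prod n R K) - Re (hs_prod n H S) - Re (hs_prod n H K)"
    "Re (hs_prod n (R - H) (S - K)) = Re (hs_prod n R S) - Re (hs_prod n R K) - Re (hs_prod n H S) + Re (hs_prod n H K)"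
    using Rc Sc
    by (simp_all add: hs_prod_add hs_prod_diff hs_prod_add_left hs_prod_diff_left)
  have "0 \<le> Re (hs_prod n (R + H) (S + K))" "0 \<le> Re (hs_prod n (R + H) (S - K))"
    "0 \<le> Re (hs_prod n (R - H) (S + K))" "0 \<le> Re (hs_prod n (R - H) (S - K))"
    using R S Rc Sc by (blast intro: hs_prod_psd_nonneg)+
  thus ?thesis unfolding e by linarith
qed

text \<open>\<open>R\<close> is the average of R - H and R + H. Together with
  \<open>dominates_self\<close> this encodes positivity as domination, so that
  \<open>psd_bi_power\<close> is an instance of \<open>dominates_bi_power\<close>.\<close>

lemma dominates_imp_psd:
  assumes "dominates n R H"
  shows "psd R"
proof -
  note R = assms[unfolded dominates_def]
  have c: "R - H \<in> carrier_mat n n" "R + H \<in> carrier_mat n n"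
    using R by (auto intro: minus_carrier_mat add_carrier_mat)
  have "psd ((R - H) + (R + H))" using R c by (blast intro: psd_add)
  hence "psd (of_real (1 / 2) \<cdot>\<^sub>m ((R - H) + (R + H)))"
    by (rule psd_smult[where n = n]) (use c in auto)
  also have "of_real (1 / 2) \<cdot>\<^sub>m ((R - H) + (R + H)) = R"
    by (rule eq_matI) (use R in auto)
  finally show ?thesis .
qed

section \<open>Trace norm and operator norm\<close>

lemma hermitian_spectral_mat:
  assumes "U \<in> carrier_mat n n"
  shows "hermitian_mat (spectral_mat n U d)"
  unfolding hermitian_mat_iff[OF spectral_mat_carrier[OF assms]]
  by (auto simp: spectral_mat_index[OF assms] cnj_sum mult_ac)

lemma spectral_mat_dim [simp]:
  "dim_row (spectral_mat n U d) = dim_row U" "dim_col (spectral_mat n U d) = dim_row U"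
  by (simp_all add: spectral_mat_def)

lemma spectral_mat_add:
  assumes U: "U \<in> carrier_mat n n"
  shows "spectral_mat n U d + spectral_mat n U d' = spectral_mat n U (\<lambda>k. d k + d' k)"
proof (rule eq_matI)
  fix i j assume "i < dim_row (spectral_mat n U (\<lambda>k. d k + d' k))" "j < dim_col (spectral_mat n U (\<lambda>k. d k + d' k))"
  hence ij: "i < n" "j < n" using U by simp_all
  have "(spectral_mat n U d + spectral_mat n U d') $$ (i, j) = spectral_mat n U d $$ (i, j) + spectral_mat n U d' $$ (i, j)"
    using U ij by simp
  also have "\<dots> = spectral_mat n U (\<lambda>k. d k + d' k) $$ (i, j)"
    unfolding spectral_mat_index[OF U ij] sum.distrib[symmetric]
    by (intro sum.cong refl) (simp add: ring_distribs)
  finally show "(spectral_mat n U d + spectral_mat n U d') $$ (i, j) = spectral_mat n U (\<lambda>k. d k + d' k) $$ (i, j)" .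
qed simp_all

lemma spectral_mat_diff:
  assumes U: "U \<in> carrier_mat n n"
  shows "spectral_mat n U d - spectral_mat n U d' = spectral_mat n U (\<lambda>k. d k - d' k)"
proof (rule eq_matI)
  fix i j assume "i < dim_row (spectral_mat n U (\<lambda>k. d k - d' k))" "j < dim_col (spectral_mat n U (\<lambda>k. d k - d' k))"
  hence ij: "i < n" "j < n" using U by simp_all
  have "(spectral_mat n U d - spectral_mat n U d') $$ (i, j) = spectral_mat n U d $$ (i, j) - spectral_mat n U d' $$ (i, j)"
    using U ij by simp
  also have "\<dots> = spectral_mat n U (\<lambda>k. d k - d' k) $$ (i, j)"
    unfolding spectral_mat_index[OF U ij] sum_subtractf[symmetric]
    by (intro sum.cong refl) (simp add: ring_distribs)
  finally show "(spectral_mat n U d - spectral_mat n U d') $$ (i, j) = spectral_mat n U (\<lambda>k. d k - d' k) $$ (i, j)" .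
qed simp_all

lemma spectral_mat_const:
  assumes "unitary_mat n U"
  shows "spectral_mat n U (\<lambda>_. c) = of_real c \<cdot>\<^sub>m 1\<^sub>m n"
proof -
  have U: "U \<in> carrier_mat n n" using assms by (simp add: unitary_mat_def)
  show ?thesis
  proof (rule eq_matI)
    fix i j assume "i < dim_row (of_real c \<cdot>\<^sub>m 1\<^sub>m n :: complex mat)" "j < dim_col (of_real c \<cdot>\<^sub>m 1\<^sub>m n :: complex mat)"
    hence ij: "i < n" "j < n" by simp_all
    show "spectral_mat n U (\<lambda>_. c) $$ (i, j) = (of_real c \<cdot>\<^sub>m 1\<^sub>m n) $$ (i, j)"
      unfolding spectral_mat_index[OF U ij] sum_distrib_left[symmetric] unitary_mat_rows[OF assms ij]
      using ij by simp
  qed (use U in simp_all)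
qed

lemma dominates_spectral_mat:
  assumes "unitary_mat n U" "\<And>k. k < n \<Longrightarrow> \<bar>d k\<bar> \<le> e k"
  shows "dominates n (spectral_mat n U e) (spectral_mat n U d)"
proof -
  have U: "U \<in> carrier_mat n n" using assms by (simp add: unitary_mat_def)
  have "0 \<le> e k - d k" "0 \<le> e k + d k" if "k < n" for k using assms(2)[OF that] by linarith+
  thus ?thesis
    unfolding dominates_def spectral_mat_add[OF U] spectral_mat_diff[OF U]
    using spectral_mat_carrier[OF U] by (auto intro!: psd_spectral_mat[OF assms(1)])
qed

lemma mtrace_spectral_mat:
  assumes "unitary_mat n U"
  shows "mtrace (spectral_mat n U d) = of_real (\<Sum>k<n. d k)"
proof -
  have U: "U \<in> carrier_mat n n" using assms by (simp add: unitary_mat_def)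
  have "mtrace (spectral_mat n U d) = (\<Sum>i<n. \<Sum>k<n. of_real (d k) * (cnj (U $$ (i, k)) * U $$ (i, k)))"
    unfolding mtrace_def using spectral_mat_carrier[OF U, of d]
    by (intro sum.cong) (auto simp: spectral_mat_index[OF U] mult_ac)
  also have "\<dots> = (\<Sum>k<n. of_real (d k) * (\<Sum>i<n. cnj (U $$ (i, k)) * U $$ (i, k)))"
    unfolding sum_distrib_left by (rule sum.swap)
  also have "\<dots> = (\<Sum>k<n. of_real (d k))"
    by (rule sum.cong) (simp_all add: unitary_mat_cols[OF assms])
  finally show ?thesis by simp
qed

lemma real_diag_mult: "real_diag n d * real_diag n e = real_diag n (\<lambda>k. d k * e k)"
proof (rule eq_matI)
  fix i j assume "i < dim_row (real_diag n (\<lambda>k. d k * e k))" "j < dim_col (real_diag n (\<lambda>k. d k * e k))"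
  hence ij: "i < n" "j < n" by (simp_all add: real_diag_def)
  show "(real_diag n d * real_diag n e) $$ (i, j) = real_diag n (\<lambda>k. d k * e k) $$ (i, j)"
    unfolding mult_real_diag_index[OF real_diag_carrier ij] using ij by (simp add: real_diag_def)
qed (simp_all add: real_diag_def)

lemma spectral_mat_mult:
  assumes "unitary_mat n U"
  shows "spectral_mat n U d * spectral_mat n U e = spectral_mat n U (\<lambda>k. d k * e k)"
proof -
  have U: "U \<in> carrier_mat n n" using assms by (simp add: unitary_mat_def)
  have aU: "mat_adjoint U \<in> carrier_mat n n" using U by simp
  have c: "U * real_diag n e \<in> carrier_mat n n" using U by (rule mult_carrier_mat) simp
  have "spectral_mat n U d * spectral_mat n U e = spectral_mat n U d * (U * real_diag n e) * mat_adjoint U"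
    unfolding spectral_mat_def[of n U e]
    by (rule assoc_mult_mat[OF spectral_mat_carrier[OF U] c aU, symmetric])
  also have "spectral_mat n U d * (U * real_diag n e) = spectral_mat n U d * U * real_diag n e"
    by (rule assoc_mult_mat[OF spectral_mat_carrier[OF U] U real_diag_carrier, symmetric])
  also have "\<dots> = U * (real_diag n d * real_diag n e)"
    unfolding spectral_mat_mult_unitary[OF assms] by (rule assoc_mult_mat[OF U real_diag_carrier real_diag_carrier])
  finally show ?thesis unfolding real_diag_mult spectral_mat_def[of n U "\<lambda>k. d k * e k"] .
qed

lemma proots_linear_factors: "proots (\<Prod>a\<leftarrow>as. [:- a, 1:]) = mset (as :: complex list)"
proof (induction as)
  case (Cons a as)
  have "(\<Prod>a\<leftarrow>as. [:- a, 1:]) \<noteq> 0" by auto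
  thus ?case using Cons by (simp add: proots_mult del: mult_pCons_left)
qed simp

text \<open>The product of the adjoint with the matrix has the same eigenbasis and eigenvalues
  d_k^2. Being similar to a diagonal matrix, it has a characteristic polynomial that splits with
  exactly these roots, repetitions included, and their square roots are |d_k|.\<close>

lemma trace_norm_spectral_mat:
  assumes "unitary_mat n U"
  shows "trace_norm (spectral_mat n U d) = (\<Sum>k<n. \<bar>d k\<bar>)"
proof -
  have U: "U \<in> carrier_mat n n" "U * mat_adjoint U = 1\<^sub>m n" "mat_adjoint U * U = 1\<^sub>m n"
    using assms by (auto simp: unitary_mat_def)
  let ?M = "spectral_mat n U d"
  have "mat_adjoint ?M = ?M" using hermitian_spectral_mat[OF U(1)] by (simp add: hermitian_mat_def)
  hence sq: "mat_adjoint ?M * ?M = spectral_mat n U (\<lambda>k. d k * d k)"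
    by (simp add: spectral_mat_mult[OF assms])
  have "similar_mat (spectral_mat n U (\<lambda>k. d k * d k)) (real_diag n (\<lambda>k. d k * d k))"
    by (rule similar_matI[OF _ U(2,3) spectral_mat_def]) (use U(1) in simp)
  hence "char_poly (mat_adjoint ?M * ?M) = char_poly (real_diag n (\<lambda>k. d k * d k))"
    unfolding sq by (rule char_poly_similar)
  also have "\<dots> = (\<Prod>a\<leftarrow>diag_mat (real_diag n (\<lambda>k. d k * d k)). [:- a, 1:])"
    by (rule char_poly_upper_triangular[OF real_diag_carrier]) (auto simp: real_diag_def)
  finally have "singular_values ?M
    = image_mset (\<lambda>z. sqrt (Re z)) (mset (diag_mat (real_diag n (\<lambda>k. d k * d k))))"
    unfolding singular_values_def by (simp only: proots_linear_factors)
  also have "diag_mat (real_diag n (\<lambda>k. d k * d k)) = map (\<lambda>k. of_real (d k * d k)) [0..<n]"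
    by (auto simp: diag_mat_def real_diag_def)
  finally have "singular_values ?M = mset (map (\<lambda>k. \<bar>d k\<bar>) [0..<n])"
    by (simp add: multiset.map_comp comp_def)
  hence "trace_norm ?M = sum_list (map (\<lambda>k. \<bar>d k\<bar>) [0..<n])"
    unfolding trace_norm_def by (simp only: sum_mset_sum_list)
  thus ?thesis by (simp add: interv_sum_list_conv_sum_set_nat lessThan_atLeast0)
qed

text \<open>The witness is the absolute value of \<open>H\<close>. Expressing the norm as a trace
  lets it be carried through tensor powers, where \<open>mtrace\<close> is multiplicative, and
  through trace-preserving maps.\<close>

lemma trace_norm_dominates:
  assumes "H \<in> carrier_mat n n" "hermitian_mat H"
  obtains R where "dominates n R H" "mtrace R = of_real (trace_norm H)"
proof -
  obtain U d where U: "unitary_mat n U" and H: "H = spectral_mat n U d"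
    using spectral_theorem[OF assms] by (elim exE conjE)
  show thesis
  proof (rule that)
    show "dominates n (spectral_mat n U (\<lambda>k. \<bar>d k\<bar>)) H"
      unfolding H using U by (rule dominates_spectral_mat) simp
    show "mtrace (spectral_mat n U (\<lambda>k. \<bar>d k\<bar>)) = of_real (trace_norm H)"
      unfolding H mtrace_spectral_mat[OF U] trace_norm_spectral_mat[OF U] ..
  qed
qed

section \<open>The operator norm of a Hermitian matrix\<close>

lemma vnorm_eq:
  assumes "v \<in> carrier_vec n"
  shows "vnorm v = sqrt (\<Sum>i<n. (cmod (v $ i))\<^sup>2)"
proof -
  have "v \<bullet>c v = of_real (\<Sum>i<n. (cmod (v $ i))\<^sup>2)"
    unfolding cscalar_prod_index[OF assms] of_real_sum by (intro sum.cong refl) (simp only: complex_norm_square)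
  thus ?thesis by (simp add: vnorm_def)
qed

text \<open>The supremum in \<open>op_norm\<close> is taken in the reals, where it bounds its
  members only if the set is bounded. A crude bound by row sums is enough, as the entries of a unit
  vector have modulus at most 1.\<close>

lemma bdd_above_op_norm:
  assumes M: "M \<in> carrier_mat n n"
  shows "bdd_above ((\<lambda>v. vnorm (M *\<^sub>v v)) ` {v \<in> carrier_vec (dim_col M). vnorm v = 1})"
proof (rule bdd_aboveI2)
  fix v assume "v \<in> {v \<in> carrier_vec (dim_col M). vnorm v = 1}"
  hence v: "v \<in> carrier_vec n" "vnorm v = 1" using M by auto
  have v1: "cmod (v $ j) \<le> 1" if j: "j < n" for j
  proof -
    have "(cmod (v $ j))\<^sup>2 \<le> (\<Sum>i<n. (cmod (v $ i))\<^sup>2)"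
      using j by (intro member_le_sum) auto
    also have "\<dots> = 1" using v(2) unfolding vnorm_eq[OF v(1)] by (simp add: real_sqrt_eq_1_iff)
    finally show ?thesis by (simp add: abs_square_le_1)
  qed
  have "cmod ((M *\<^sub>v v) $ i) \<le> (\<Sum>j<n. cmod (M $$ (i, j)))" if i: "i < n" for i
  proof -
    have "cmod ((M *\<^sub>v v) $ i) \<le> (\<Sum>j<n. cmod (M $$ (i, j) * v $ j))"
      unfolding mult_mat_vec_index[OF M v(1) i] by (rule norm_sum)
    also have "\<dots> \<le> (\<Sum>j<n. cmod (M $$ (i, j)))"
      by (rule sum_mono) (use v1 in \<open>simp add: norm_mult mult_left_le\<close>)
    finally show ?thesis .
  qed
  thus "vnorm (M *\<^sub>v v) \<le> sqrt (\<Sum>i<n. (\<Sum>j<n. cmod (M $$ (i, j)))\<^sup>2)"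
    using vnorm_eq[OF mult_mat_vec_carrier[OF M v(1)]]
    by (auto intro!: sum_mono power_mono)
qed

text \<open>The columns of \<open>U\<close> are unit vectors, so testing them shows that no |d_k|
  exceeds the norm; a constant spectrum is a multiple of the identity in any eigenbasis.\<close>

lemma op_norm_dominates:
  assumes M: "M \<in> carrier_mat n n" and "hermitian_mat M"
  shows "dominates n (of_real (op_norm M) \<cdot>\<^sub>m 1\<^sub>m n) M"
proof -
  obtain U d where U: "unitary_mat n U" and Md: "M = spectral_mat n U d"
    using spectral_theorem[OF assms] by (elim exE conjE)
  have Uc: "U \<in> carrier_mat n n" using U by (simp add: unitary_mat_def)
  have "\<bar>d k\<bar> \<le> op_norm M" if k: "k < n" for k
  proof -
    define v where "v = vec n (\<lambda>i. U $$ (i, k))"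
    have v: "v \<in> carrier_vec n" by (simp add: v_def)
    have "complex_of_real (\<Sum>i<n. (cmod (U $$ (i, k)))\<^sup>2) = (\<Sum>i<n. cnj (U $$ (i, k)) * U $$ (i, k))"
      unfolding of_real_sum by (intro sum.cong refl) (simp only: complex_norm_square mult.commute)
    also have "\<dots> = of_real 1" unfolding unitary_mat_cols[OF U k k] by simp
    finally have n1: "(\<Sum>i<n. (cmod (U $$ (i, k)))\<^sup>2) = 1" by (simp only: of_real_eq_iff)
    have "vnorm v = 1" unfolding vnorm_eq[OF v] using n1 by (simp add: v_def)
    hence "v \<in> {v \<in> carrier_vec (dim_col M). vnorm v = 1}" using M v by simp
    hence "vnorm (M *\<^sub>v v) \<le> op_norm M"
      unfolding op_norm_def by (rule cSUP_upper[OF _ bdd_above_op_norm[OF M]])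
    moreover have "vnorm (M *\<^sub>v v) = \<bar>d k\<bar>"
    proof -
      have "(M *\<^sub>v v) $ i = of_real (d k) * U $$ (i, k)" if "i < n" for i
        unfolding mult_mat_vec_index[OF M v that] unfolding Md spectral_mat_eigen[OF U that k, symmetric]
        by (intro sum.cong refl) (simp add: v_def)
      hence "vnorm (M *\<^sub>v v) = sqrt (\<Sum>i<n. (d k)\<^sup>2 * (cmod (U $$ (i, k)))\<^sup>2)"
        unfolding vnorm_eq[OF mult_mat_vec_carrier[OF M v]] by (simp add: norm_mult power_mult_distrib)
      also have "\<dots> = \<bar>d k\<bar>" unfolding sum_distrib_left[symmetric] n1 by simp
      finally show ?thesis .
    qed
    ultimately show ?thesis by simp
  qed
  hence "dominates n (spectral_mat n U (\<lambda>_. op_norm M)) M"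
    unfolding Md using U by (intro dominates_spectral_mat) auto
  thus ?thesis unfolding spectral_mat_const[OF U] .
qed

text \<open>In dimension zero there is no unit vector and \<open>op_norm\<close> is the unspecified value \<open>Sup {}\<close>.\<close>

lemma op_norm_nonneg:
  assumes M: "M \<in> carrier_mat n n" and n: "0 < n"
  shows "0 \<le> op_norm M"
proof -
  have v: "unit_vec n 0 \<in> carrier_vec n" by simp
  have "(\<Sum>i<n. (cmod (unit_vec n 0 $ i))\<^sup>2) = (\<Sum>i<n. if i = 0 then 1 else 0)"
    by (rule sum.cong) auto
  hence "vnorm (unit_vec n 0) = 1" unfolding vnorm_eq[OF v] using n by simp
  hence "unit_vec n 0 \<in> {v \<in> carrier_vec (dim_col M). vnorm v = 1}" using M by simp
  hence "vnorm (M *\<^sub>v unit_vec n 0) \<le> op_norm M"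
    unfolding op_norm_def by (rule cSUP_upper[OF _ bdd_above_op_norm[OF M]])
  moreover have "0 \<le> vnorm (M *\<^sub>v unit_vec n 0)"
    unfolding vnorm_eq[OF mult_mat_vec_carrier[OF M v]] by (simp add: sum_nonneg)
  ultimately show ?thesis by simp
qed

section \<open>Partial transposes and bipartite tensor products\<close>

lemma mixed_radix_less:
  assumes "q < (a::nat)" "s < b"
  shows "q * b + s < a * b"
proof -
  have "q * b + s < (q + 1) * b" using assms(2) by simp
  also have "\<dots> \<le> a * b" using assms(1) by (intro mult_right_mono) auto
  finally show ?thesis .
qed

lemma mixed_radix_div_mod:
  assumes "s < (b::nat)"
  shows "(q * b + s) div b = q" "(q * b + s) mod b = s"
  using assms by simp_all

section \<open>Partial transposition\<close>

lemma partial_transpose_carrier [simp]: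
  "M \<in> carrier_mat n m \<Longrightarrow> partial_transpose b M \<in> carrier_mat n m"
  by (auto simp: partial_transpose_def)

lemma partial_transpose_index:
  assumes "M \<in> carrier_mat n m" "r < n" "c < m"
  shows "partial_transpose b M $$ (r, c) = M $$ ((r div b) * b + c mod b, (c div b) * b + r mod b)"
  using assms by (simp add: partial_transpose_def)

lemma partial_transpose_less:
  assumes "r < a * b" "c < a * (b::nat)"
  shows "(r div b) * b + c mod b < a * b"
proof -
  have "0 < b" using assms(1) by (cases b) auto
  thus ?thesis using assms by (intro mixed_radix_less) (auto simp: less_mult_imp_div_less)
qed

text \<open>Partial transposition moves entries by an involution of the index pairs that commutes
  with exchanging row and column, so it merely permutes the terms of the double sum.\<close>

lemma hs_prod_partial_transpose:
  assumes M: "M \<in> carrier_mat (a * b) (a * b)" and N: "N \<in> carrier_mat (a * b) (a * b)"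
  shows "hs_prod (a * b) (partial_transpose b M) (partial_transpose b N) = hs_prod (a * b) M N"
proof -
  define sw where "sw = (\<lambda>(r, c). ((r div b) * b + c mod b, (c div b) * b + r mod b))"
  let ?S = "{..<a * b} \<times> {..<a * b}"
  have sw: "sw x \<in> ?S" "sw (sw x) = x" if "x \<in> ?S" for x
  proof -
    obtain r c where x: "x = (r, c)" by (cases x)
    have rc: "r < a * b" "c < a * b" using that x by auto
    have b: "0 < b" using rc(1) by (cases b) auto
    show "sw x \<in> ?S" using rc by (auto simp: x sw_def partial_transpose_less)
    show "sw (sw x) = x" using b by (simp add: x sw_def)
  qed
  have "(\<Sum>(r, c)\<in>?S. partial_transpose b M $$ (r, c) * partial_transpose b N $$ (c, r))
      = (\<Sum>(r, c)\<in>?S. M $$ (r, c) * N $$ (c, r))"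
    by (rule sum.reindex_bij_witness[of _ sw sw])
      (use sw in \<open>auto simp: sw_def partial_transpose_index[OF M] partial_transpose_index[OF N]\<close>)
  thus ?thesis unfolding hs_prod_def sum.cartesian_product .
qed

lemma partial_transpose_involution:
  assumes M: "M \<in> carrier_mat (a * b) (a * b)"
  shows "partial_transpose b (partial_transpose b M) = M"
proof (rule eq_matI)
  fix r c assume "r < dim_row M" "c < dim_col M"
  hence rc: "r < a * b" "c < a * b" using M by auto
  have b: "0 < b" using rc(1) by (cases b) auto
  show "partial_transpose b (partial_transpose b M) $$ (r, c) = M $$ (r, c)"
    unfolding partial_transpose_index[OF partial_transpose_carrier[OF M] rc]
      partial_transpose_index[OF M partial_transpose_less[OF rc] partial_transpose_less[OF rc(2,1)]]
    using b by simp
qed (auto simp: partial_transpose_def)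

lemma mtrace_partial_transpose: "square_mat M \<Longrightarrow> mtrace (partial_transpose b M) = mtrace M"
  by (simp add: mtrace_def partial_transpose_def)

lemma partial_transpose_hermitian:
  assumes M: "M \<in> carrier_mat (a * b) (a * b)" and h: "hermitian_mat M"
  shows "hermitian_mat (partial_transpose b M)"
  unfolding hermitian_mat_iff[OF partial_transpose_carrier[OF M]]
proof (intro allI impI)
  fix r c assume rc: "r < a * b" "c < a * b"
  show "partial_transpose b M $$ (c, r) = cnj (partial_transpose b M $$ (r, c))"
    unfolding partial_transpose_index[OF M rc] partial_transpose_index[OF M rc(2,1)]
    using h partial_transpose_less[OF rc] partial_transpose_less[OF rc(2,1)]
    unfolding hermitian_mat_iff[OF M] by blast
qed

lemma partial_transpose_one: "partial_transpose b (1\<^sub>m (a * b)) = 1\<^sub>m (a * b)"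
proof (rule eq_matI)
  fix r c assume "r < dim_row (1\<^sub>m (a * b) :: complex mat)" "c < dim_col (1\<^sub>m (a * b) :: complex mat)"
  hence rc: "r < a * b" "c < a * b" by auto
  have b: "0 < b" using rc(1) by (cases b) auto
  have "(r div b) * b + c mod b = (c div b) * b + r mod b \<longleftrightarrow> r = c"
  proof
    assume e: "(r div b) * b + c mod b = (c div b) * b + r mod b"
    have "r div b = c div b" using arg_cong[OF e, of "\<lambda>x. x div b"] b by simp
    moreover have "c mod b = r mod b" using arg_cong[OF e, of "\<lambda>x. x mod b"] b by simp
    ultimately show "r = c" by (metis div_mult_mod_eq)
  qed simp
  thus "partial_transpose b (1\<^sub>m (a * b)) $$ (r, c) = (1\<^sub>m (a * b) :: complex mat) $$ (r, c)"
    unfolding partial_transpose_index[OF one_carrier_mat rc]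
    using rc partial_transpose_less[OF rc] partial_transpose_less[OF rc(2,1)] by simp
qed (auto simp: partial_transpose_def)

section \<open>Regrouping the indices of a tensor product\<close>

text \<open>An index \<open>r\<close> of the regrouped space has mixed-radix digits (i, i', j, j'),
  with Alice's before Bob's; \<open>bi_index\<close> keeps (i, j) and \<open>bi_index'\<close> keeps
  (i', j'). The third claim reassembles \<open>r\<close>, the last four read off single
  digits.\<close>

lemma bi_index_less:
  assumes "r < (a * a') * (b * b')"
  shows "bi_index b a' b' r < a * b" "bi_index' b a' b' r < a' * b'"
    "((bi_index b a' b' r div b) * a' + bi_index' b a' b' r div b') * (b * b')
      + ((bi_index b a' b' r mod b) * b' + bi_index' b a' b' r mod b') = r"
    "bi_index b a' b' r div b = r div (b * b') div a'" "bi_index b a' b' r mod b = r mod (b * b') div b'"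
    "bi_index' b a' b' r div b' = r div (b * b') mod a'" "bi_index' b a' b' r mod b' = r mod (b * b') mod b'"
proof -
  have pos: "0 < a'" "0 < b" "0 < b'" using assms by (cases "a' = 0"; cases "b = 0"; cases "b' = 0"; simp)+
  have q: "r div (b * b') < a * a'" using assms by (simp add: less_mult_imp_div_less)
  have s: "r mod (b * b') < b * b'" using pos by simp
  have s1: "r mod (b * b') div b' < b" using s by (simp add: less_mult_imp_div_less)
  have s2: "r mod (b * b') mod b' < b'" using pos by simp
  have q1: "r div (b * b') div a' < a" using q by (simp add: less_mult_imp_div_less)
  have q2: "r div (b * b') mod a' < a'" using pos by simp
  show "bi_index b a' b' r < a * b" "bi_index' b a' b' r < a' * b'"
    unfolding bi_index_def bi_index'_def using q1 q2 s1 s2 by (auto intro: mixed_radix_less)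
  show d1: "bi_index b a' b' r div b = r div (b * b') div a'" "bi_index b a' b' r mod b = r mod (b * b') div b'"
    "bi_index' b a' b' r div b' = r div (b * b') mod a'" "bi_index' b a' b' r mod b' = r mod (b * b') mod b'"
    unfolding bi_index_def bi_index'_def using pos s1 s2 by auto
  show "((bi_index b a' b' r div b) * a' + bi_index' b a' b' r div b') * (b * b')
      + ((bi_index b a' b' r mod b) * b' + bi_index' b a' b' r mod b') = r"
    unfolding d1 div_mult_mod_eq ..
qed

lemma bi_index_inverse:
  assumes "x < a * b" "x' < a' * b'"
  defines "r \<equiv> ((x div b) * a' + x' div b') * (b * b') + ((x mod b) * b' + x' mod b')"
  shows "r < (a * a') * (b * b')" "bi_index b a' b' r = x" "bi_index' b a' b' r = x'"
proof -
  have pos: "0 < b" "0 < b'" using assms(1,2) by (cases "b = 0"; cases "b' = 0"; simp)+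
  have 1: "x div b < a" "x' div b' < a'" using assms(1,2) by (auto simp: less_mult_imp_div_less)
  have s: "(x mod b) * b' + x' mod b' < b * b'" using pos by (intro mixed_radix_less) auto
  show "r < (a * a') * (b * b')"
    unfolding r_def by (rule mixed_radix_less[OF mixed_radix_less[OF 1] s])
  have "r div (b * b') = (x div b) * a' + x' div b'" "r mod (b * b') = (x mod b) * b' + x' mod b'"
    unfolding r_def by (rule mixed_radix_div_mod[OF s])+
  thus "bi_index b a' b' r = x" "bi_index' b a' b' r = x'"
    unfolding bi_index_def bi_index'_def using 1 pos by simp_all
qed

text \<open>Regrouping is a bijection between the indices of the product and pairs of indices of the
  factors. This is the common source of multiplicativity for the trace and for the trace
  pairing.\<close>

lemma sum_bi_index:
  "(\<Sum>r<(a * a') * (b * b'). g (bi_index b a' b' r) (bi_index' b a' b' r))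
    = (\<Sum>x<a * b. \<Sum>x'<a' * b'. (g x x' :: 'a::comm_monoid_add))"
proof -
  define i where "i = (\<lambda>(x, x'). ((x div b) * a' + x' div b') * (b * b') + ((x mod b) * b' + x' mod b'))"
  define j where "j r = (bi_index b a' b' r, bi_index' b a' b' r)" for r
  have "(\<Sum>r<(a * a') * (b * b'). g (bi_index b a' b' r) (bi_index' b a' b' r))
    = (\<Sum>(x, x')\<in>{..<a * b} \<times> {..<a' * b'}. g x x')"
  proof (rule sum.reindex_bij_witness[of _ i j])
    fix r assume "r \<in> {..<(a * a') * (b * b')}"
    hence r: "r < (a * a') * (b * b')" by simp
    show "i (j r) = r" unfolding i_def j_def prod.case by (rule bi_index_less(3)[OF r])
    show "j r \<in> {..<a * b} \<times> {..<a' * b'}" unfolding j_def using bi_index_less(1,2)[OF r] by simp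
    show "(case j r of (x, x') \<Rightarrow> g x x') = g (bi_index b a' b' r) (bi_index' b a' b' r)" by (simp add: j_def)
  next
    fix p assume "p \<in> {..<a * b} \<times> {..<a' * b'}"
    then obtain x x' where p: "p = (x, x')" "x < a * b" "x' < a' * b'" by auto
    show "j (i p) = p" "i p \<in> {..<(a * a') * (b * b')}"
      unfolding i_def j_def p(1) prod.case using bi_index_inverse[OF p(2,3)] by simp_all
  qed
  thus ?thesis by (simp only: sum.cartesian_product)
qed

lemma bi_tensor_carrier [simp]:
  "bi_tensor a b a' b' M N \<in> carrier_mat ((a * a') * (b * b')) ((a * a') * (b * b'))"
  by (simp add: bi_tensor_def)

lemma bi_tensor_index:
  "r < (a * a') * (b * b') \<Longrightarrow> c < (a * a') * (b * b') \<Longrightarrow> bi_tensor a b a' b' M N $$ (r, c)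
    = M $$ (bi_index b a' b' r, bi_index b a' b' c) * N $$ (bi_index' b a' b' r, bi_index' b a' b' c)"
  by (simp add: bi_tensor_def)

lemma hs_prod_bi_tensor:
  "hs_prod ((a * a') * (b * b')) (bi_tensor a b a' b' M N) (bi_tensor a b a' b' M' N')
    = hs_prod (a * b) M M' * hs_prod (a' * b') N N'"
proof -
  let ?n = "(a * a') * (b * b')" and ?x = "bi_index b a' b'" and ?x' = "bi_index' b a' b'"
  define g where "g x x' y y' = (M $$ (x, y) * M' $$ (y, x)) * (N $$ (x', y') * N' $$ (y', x'))" for x x' y y'
  have "hs_prod ?n (bi_tensor a b a' b' M N) (bi_tensor a b a' b' M' N')
    = (\<Sum>r<?n. \<Sum>c<?n. g (?x r) (?x' r) (?x c) (?x' c))"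
    unfolding hs_prod_def by (intro sum.cong refl) (simp add: bi_tensor_index g_def)
  also have "\<dots> = (\<Sum>r<?n. \<Sum>y<a * b. \<Sum>y'<a' * b'. g (?x r) (?x' r) y y')"
    by (rule sum.cong[OF refl]) (rule sum_bi_index)
  also have "\<dots> = (\<Sum>x<a * b. \<Sum>x'<a' * b'. \<Sum>y<a * b. \<Sum>y'<a' * b'. g x x' y y')"
    by (rule sum_bi_index[where g = "\<lambda>x x'. \<Sum>y<a * b. \<Sum>y'<a' * b'. g x x' y y'"])
  also have "\<dots> = hs_prod (a * b) M M' * hs_prod (a' * b') N N'"
    unfolding hs_prod_def g_def by (simp only: sum_product)
  finally show ?thesis .
qed

lemma mtrace_bi_tensor:
  assumes M: "M \<in> carrier_mat (a * b) (a * b)" and N: "N \<in> carrier_mat (a' * b') (a' * b')"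
  shows "mtrace (bi_tensor a b a' b' M N) = mtrace M * mtrace N"
proof -
  have "mtrace (bi_tensor a b a' b' M N) = (\<Sum>r<(a * a') * (b * b').
      (\<lambda>x x'. M $$ (x, x) * N $$ (x', x')) (bi_index b a' b' r) (bi_index' b a' b' r))"
    unfolding mtrace_def by (rule sum.cong) (simp_all add: bi_tensor_def)
  also have "\<dots> = (\<Sum>x<a * b. \<Sum>x'<a' * b'. M $$ (x, x) * N $$ (x', x'))"
    by (rule sum_bi_index[where g = "\<lambda>x x'. M $$ (x, x) * N $$ (x', x')"])
  finally show ?thesis using M N by (simp add: mtrace_def sum_product)
qed

text \<open>Products of Gram vectors of the two factors, indexed by pairs, are Gram vectors of the
  tensor product.\<close>

lemma psd_bi_tensor:
  assumes "psd M" "psd N" "M \<in> carrier_mat (a * b) (a * b)" "N \<in> carrier_mat (a' * b') (a' * b')"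
  shows "psd (bi_tensor a b a' b' M N)"
proof -
  obtain f where f: "\<And>i j. i < a * b \<Longrightarrow> j < a * b \<Longrightarrow> M $$ (i, j) = (\<Sum>k<a * b. f k i * cnj (f k j))"
    using psd_gramE[OF assms(1,3)] by blast
  obtain g where g: "\<And>i j. i < a' * b' \<Longrightarrow> j < a' * b' \<Longrightarrow> N $$ (i, j) = (\<Sum>k<a' * b'. g k i * cnj (g k j))"
    using psd_gramE[OF assms(2,4)] by blast
  let ?x = "bi_index b a' b'" and ?x' = "bi_index' b a' b'"
  show ?thesis
  proof (rule psd_gramI[where K = "{..<a * b} \<times> {..<a' * b'}" and f = "\<lambda>(k, l) r. f k (?x r) * g l (?x' r)"])
    fix r c assume rc: "r < (a * a') * (b * b')" "c < (a * a') * (b * b')"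
    note lr = bi_index_less(1,2)[OF rc(1)] and lc = bi_index_less(1,2)[OF rc(2)]
    have "bi_tensor a b a' b' M N $$ (r, c) = (\<Sum>k<a * b. \<Sum>l<a' * b'.
        (f k (?x r) * cnj (f k (?x c))) * (g l (?x' r) * cnj (g l (?x' c))))"
      unfolding bi_tensor_index[OF rc] f[OF lr(1) lc(1)] g[OF lr(2) lc(2)] by (rule sum_product)
    also have "\<dots> = (\<Sum>kl\<in>{..<a * b} \<times> {..<a' * b'}. (case kl of (k, l) \<Rightarrow> \<lambda>r. f k (?x r) * g l (?x' r)) r
        * cnj ((case kl of (k, l) \<Rightarrow> \<lambda>r. f k (?x r) * g l (?x' r)) c))"
      unfolding sum.cartesian_product by (rule sum.cong) (auto simp: mult_ac)
    finally show "bi_tensor a b a' b' M N $$ (r, c) = \<dots>" .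
  qed simp
qed

text \<open>Exchanging the joint Bob index \<open>r mod (b * b')\<close> exchanges both of its
  digits, so transposing the whole of Bob's side transposes each factor. Grouping all of Alice's
  systems before all of Bob's makes this work.\<close>

lemma partial_transpose_bi_tensor:
  assumes M: "M \<in> carrier_mat (a * b) (a * b)" and N: "N \<in> carrier_mat (a' * b') (a' * b')"
  shows "partial_transpose (b * b') (bi_tensor a b a' b' M N)
    = bi_tensor a b a' b' (partial_transpose b M) (partial_transpose b' N)"
proof (rule eq_matI)
  fix r c assume "r < dim_row (bi_tensor a b a' b' (partial_transpose b M) (partial_transpose b' N))"
    "c < dim_col (bi_tensor a b a' b' (partial_transpose b M) (partial_transpose b' N))"
  hence rc: "r < (a * a') * (b * b')" "c < (a * a') * (b * b')" by (auto simp: bi_tensor_def)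
  let ?x = "bi_index b a' b'" and ?x' = "bi_index' b a' b'"
  have swap: "?x ((r div (b * b')) * (b * b') + c mod (b * b')) = (?x r div b) * b + ?x c mod b"
    "?x' ((r div (b * b')) * (b * b') + c mod (b * b')) = (?x' r div b') * b' + ?x' c mod b'"
    if rc: "r < (a * a') * (b * b')" "c < (a * a') * (b * b')" for r c
  proof -
    have "0 < b * b'" using rc(1) by (cases "b * b' = 0") auto
    hence "(r div (b * b') * (b * b') + c mod (b * b')) div (b * b') = r div (b * b')"
      "(r div (b * b') * (b * b') + c mod (b * b')) mod (b * b') = c mod (b * b')" by simp_all
    thus "?x ((r div (b * b')) * (b * b') + c mod (b * b')) = (?x r div b) * b + ?x c mod b"
      "?x' ((r div (b * b')) * (b * b') + c mod (b * b')) = (?x' r div b') * b' + ?x' c mod b'"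
      unfolding bi_index_less(4,6)[OF rc(1)] bi_index_less(5,7)[OF rc(2)]
      unfolding bi_index_def bi_index'_def by simp_all
  qed
  note lr = bi_index_less(1,2)[OF rc(1)] and lc = bi_index_less(1,2)[OF rc(2)]
  show "partial_transpose (b * b') (bi_tensor a b a' b' M N) $$ (r, c)
      = bi_tensor a b a' b' (partial_transpose b M) (partial_transpose b' N) $$ (r, c)"
    unfolding partial_transpose_index[OF bi_tensor_carrier rc] bi_tensor_index[OF rc]
      partial_transpose_index[OF M lr(1) lc(1)] partial_transpose_index[OF N lr(2) lc(2)]
      bi_tensor_index[OF partial_transpose_less[OF rc] partial_transpose_less[OF rc(2,1)]]
      swap[OF rc] swap[OF rc(2,1)] ..
qed (auto simp: partial_transpose_def bi_tensor_def)

lemma bi_tensor_one: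
  "bi_tensor a b a' b' (c \<cdot>\<^sub>m 1\<^sub>m (a * b)) (d \<cdot>\<^sub>m 1\<^sub>m (a' * b')) = (c * d) \<cdot>\<^sub>m 1\<^sub>m ((a * a') * (b * b'))"
proof (rule eq_matI)
  fix r s assume "r < dim_row ((c * d) \<cdot>\<^sub>m 1\<^sub>m ((a * a') * (b * b')) :: complex mat)"
    "s < dim_col ((c * d) \<cdot>\<^sub>m 1\<^sub>m ((a * a') * (b * b')) :: complex mat)"
  hence rs: "r < (a * a') * (b * b')" "s < (a * a') * (b * b')" by auto
  have "bi_index b a' b' r = bi_index b a' b' s \<and> bi_index' b a' b' r = bi_index' b a' b' s \<longleftrightarrow> r = s"
    using bi_index_less(3)[OF rs(1)] bi_index_less(3)[OF rs(2)] by metis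
  thus "bi_tensor a b a' b' (c \<cdot>\<^sub>m 1\<^sub>m (a * b)) (d \<cdot>\<^sub>m 1\<^sub>m (a' * b')) $$ (r, s)
      = ((c * d) \<cdot>\<^sub>m 1\<^sub>m ((a * a') * (b * b'))) $$ (r, s)"
    unfolding bi_tensor_index[OF rs]
    using rs bi_index_less(1,2)[OF rs(1)] bi_index_less(1,2)[OF rs(2)] by auto
qed (auto simp: bi_tensor_def)

text \<open>The polarisation of \<open>hs_prod_dominates\<close> with tensor products in place of
  traces: the terms with opposite signs average to the difference, those with equal signs to the
  sum.\<close>

lemma dominates_bi_tensor:
  assumes "dominates (a * b) R H" "dominates (a' * b') S K"
  shows "dominates ((a * a') * (b * b')) (bi_tensor a b a' b' R S) (bi_tensor a b a' b' H K)"
proof -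
  let ?T = "bi_tensor a b a' b'" and ?n = "(a * a') * (b * b')"
  note R = assms(1)[unfolded dominates_def] and S = assms(2)[unfolded dominates_def]
  have Rc: "R \<in> carrier_mat (a * b) (a * b)" "H \<in> carrier_mat (a * b) (a * b)"
      "R - H \<in> carrier_mat (a * b) (a * b)" "R + H \<in> carrier_mat (a * b) (a * b)"
    and Sc: "S \<in> carrier_mat (a' * b') (a' * b')" "K \<in> carrier_mat (a' * b') (a' * b')"
      "S - K \<in> carrier_mat (a' * b') (a' * b')" "S + K \<in> carrier_mat (a' * b') (a' * b')"
    using R S by (auto intro: minus_carrier_mat add_carrier_mat)
  have p: "psd (of_real (1 / 2) \<cdot>\<^sub>m (?T A B + ?T C D))"
    if "psd A" "psd B" "psd C" "psd D" "A \<in> carrier_mat (a * b) (a * b)" "C \<in> carrier_mat (a * b) (a * b)"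
      "B \<in> carrier_mat (a' * b') (a' * b')" "D \<in> carrier_mat (a' * b') (a' * b')" for A B C D
    by (rule psd_smult[where n = ?n], rule psd_add[where n = ?n])
      (use that in \<open>auto intro: psd_bi_tensor\<close>)
  have "?T R S - ?T H K = of_real (1 / 2) \<cdot>\<^sub>m (?T (R + H) (S - K) + ?T (R - H) (S + K))"
  proof (rule eq_matI)
    fix r c assume "r < dim_row (of_real (1 / 2) \<cdot>\<^sub>m (?T (R + H) (S - K) + ?T (R - H) (S + K)))"
      "c < dim_col (of_real (1 / 2) \<cdot>\<^sub>m (?T (R + H) (S - K) + ?T (R - H) (S + K)))"
    hence rc: "r < ?n" "c < ?n" by (auto simp: bi_tensor_def)
    show "(?T R S - ?T H K) $$ (r, c) = (of_real (1 / 2) \<cdot>\<^sub>m (?T (R + H) (S - K) + ?T (R - H) (S + K))) $$ (r, c)"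
      using rc bi_index_less(1,2)[OF rc(1)] bi_index_less(1,2)[OF rc(2)] Rc Sc
      by (simp add: bi_tensor_def field_simps)
  qed (auto simp: bi_tensor_def)
  moreover have "?T R S + ?T H K = of_real (1 / 2) \<cdot>\<^sub>m (?T (R + H) (S + K) + ?T (R - H) (S - K))"
  proof (rule eq_matI)
    fix r c assume "r < dim_row (of_real (1 / 2) \<cdot>\<^sub>m (?T (R + H) (S + K) + ?T (R - H) (S - K)))"
      "c < dim_col (of_real (1 / 2) \<cdot>\<^sub>m (?T (R + H) (S + K) + ?T (R - H) (S - K)))"
    hence rc: "r < ?n" "c < ?n" by (auto simp: bi_tensor_def)
    show "(?T R S + ?T H K) $$ (r, c) = (of_real (1 / 2) \<cdot>\<^sub>m (?T (R + H) (S + K) + ?T (R - H) (S - K))) $$ (r, c)"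
      using rc bi_index_less(1,2)[OF rc(1)] bi_index_less(1,2)[OF rc(2)] Rc Sc
      by (simp add: bi_tensor_def field_simps)
  qed (auto simp: bi_tensor_def)
  moreover have "psd (of_real (1 / 2) \<cdot>\<^sub>m (?T (R + H) (S - K) + ?T (R - H) (S + K)))"
    "psd (of_real (1 / 2) \<cdot>\<^sub>m (?T (R + H) (S + K) + ?T (R - H) (S - K)))"
    using R S Rc Sc by (simp_all only: p)
  ultimately show ?thesis by (simp add: dominates_def)
qed

section \<open>Bipartite tensor powers\<close>

lemma bi_power_carrier [simp]: "bi_power a b M n \<in> carrier_mat (a ^ n * b ^ n) (a ^ n * b ^ n)"
proof (cases n)
  case (Suc k)
  \<comment> \<open>\<open>power_Suc2\<close> puts the new factor on the right, matching the order
    in which \<open>bi_power\<close> passes dimensions to \<open>bi_tensor\<close>.\<close>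
  thus ?thesis using bi_tensor_carrier[of "a ^ k" "b ^ k" a b] by (simp only: bi_power.simps power_Suc2)
qed simp

lemma dominates_bi_power:
  assumes "dominates (a * b) R H"
  shows "dominates (a ^ n * b ^ n) (bi_power a b R n) (bi_power a b H n)"
proof (induction n)
  case 0
  show ?case using dominates_self[OF psd_one[of 1]] by simp
next
  case (Suc n)
  show ?case unfolding bi_power.simps power_Suc2 by (rule dominates_bi_tensor[OF Suc assms])
qed

lemma hs_prod_bi_power:
  "hs_prod (a ^ n * b ^ n) (bi_power a b M n) (bi_power a b N n) = hs_prod (a * b) M N ^ n"
proof (induction n)
  case 0
  show ?case by (simp add: hs_prod_def)
next
  case (Suc n)
  show ?case unfolding bi_power.simps power_Suc2 hs_prod_bi_tensor Suc ..
qed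

lemma mtrace_bi_power:
  assumes "M \<in> carrier_mat (a * b) (a * b)"
  shows "mtrace (bi_power a b M n) = mtrace M ^ n"
proof (induction n)
  case 0
  show ?case by (simp add: mtrace_def)
next
  case (Suc n)
  show ?case unfolding bi_power.simps power_Suc2 mtrace_bi_tensor[OF bi_power_carrier assms] Suc ..
qed

lemma partial_transpose_bi_power:
  assumes "M \<in> carrier_mat (a * b) (a * b)"
  shows "partial_transpose (b ^ n) (bi_power a b M n) = bi_power a b (partial_transpose b M) n"
proof (induction n)
  case 0
  show ?case using partial_transpose_one[of 1 1] by simp
next
  case (Suc n)
  show ?case unfolding bi_power.simps power_Suc2 partial_transpose_bi_tensor[OF bi_power_carrier assms] Suc ..
qed

lemma bi_power_one:
  "bi_power a b (c \<cdot>\<^sub>m 1\<^sub>m (a * b)) n = c ^ n \<cdot>\<^sub>m 1\<^sub>m (a ^ n * b ^ n)"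
proof (induction n)
  case 0
  show ?case by (rule eq_matI) auto
next
  case (Suc n)
  show ?case unfolding bi_power.simps power_Suc2 Suc bi_tensor_one ..
qed

section \<open>Completely positive maps and domination\<close>

lemma completely_positive_psd:
  assumes L: "completely_positive d d' L" and M: "M \<in> carrier_mat d d" "psd M"
  shows "psd (L M)"
proof -
  have LM: "L M \<in> carrier_mat d' d'" using L M(1) by (simp add: completely_positive_def linear_map_def)
  have blk: "block d M 0 0 = M" by (rule eq_matI) (use M(1) in \<open>auto simp: block_def\<close>)
  \<comment> \<open>For k = 1 there is a single block, so the ampliation is the map itself.\<close>
  have "ampliation 1 d d' L M = L M"
    by (rule eq_matI) (use LM in \<open>auto simp: ampliation_def blk\<close>)
  moreover have "psd (ampliation 1 d d' L M)"
  proof -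
    have "\<forall>M \<in> carrier_mat (1 * d) (1 * d). psd M \<longrightarrow> psd (ampliation 1 d d' L M)"
      using L unfolding completely_positive_def by blast
    thus ?thesis using M by simp
  qed
  ultimately show ?thesis by simp
qed

lemma linear_map_diff:
  assumes L: "linear_map d d' L" and M: "M \<in> carrier_mat d d" and N: "N \<in> carrier_mat d d"
  shows "L (M - N) = L M - L N"
proof -
  have LM: "L M \<in> carrier_mat d' d'" and LN: "L N \<in> carrier_mat d' d'"
    using L M N by (simp_all add: linear_map_def)
  have N': "(-1) \<cdot>\<^sub>m N \<in> carrier_mat d d" using N by simp
  have "M - N = M + (-1) \<cdot>\<^sub>m N" by (rule eq_matI) (use M N in auto)
  hence "L (M - N) = L M + (-1) \<cdot>\<^sub>m L N"
    using L M N N' unfolding linear_map_def by simp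
  also have "\<dots> = L M - L N" by (rule eq_matI) (use LM LN in auto)
  finally show ?thesis .
qed

lemma dominates_completely_positive:
  assumes L: "completely_positive d d' L" and R: "dominates d R H"
  shows "dominates d' (L R) (L H)"
proof -
  have lin: "linear_map d d' L" using L by (simp add: completely_positive_def)
  have R: "R \<in> carrier_mat d d" "H \<in> carrier_mat d d" "psd (R - H)" "psd (R + H)"
    using assms(2) by (simp_all add: dominates_def)
  have c: "R - H \<in> carrier_mat d d" "R + H \<in> carrier_mat d d"
    using R by (auto intro: minus_carrier_mat add_carrier_mat)
  have "L R - L H = L (R - H)" using linear_map_diff[OF lin] R by simp
  moreover have "L R + L H = L (R + H)" using lin R by (simp add: linear_map_def)
  moreover have "psd (L (R - H))" "psd (L (R + H))"
    using completely_positive_psd[OF L c(1)] completely_positive_psd[OF L c(2)] R by blast+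
  moreover have "L R \<in> carrier_mat d' d'" "L H \<in> carrier_mat d' d'"
    using lin R by (simp_all add: linear_map_def)
  ultimately show ?thesis by (simp add: dominates_def)
qed

section \<open>Projections and the Bell state\<close>

text \<open>\<open>P\<close> is the product of itself and its adjoint, so its columns are a Gram
  family for it.\<close>

lemma psd_projection:
  assumes P: "P \<in> carrier_mat n n" and h: "hermitian_mat P" and idem: "P * P = P"
  shows "psd P"
proof (rule psd_gramI[OF P, where K = "{..<n}" and f = "\<lambda>k i. P $$ (i, k)"])
  fix i j assume ij: "i < n" "j < n"
  have "P $$ (k, j) = cnj (P $$ (j, k))" if "k < n" for k
    using h ij that unfolding hermitian_mat_iff[OF P] by blast
  hence "(P * P) $$ (i, j) = (\<Sum>k<n. P $$ (i, k) * cnj (P $$ (j, k)))"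
    unfolding mult_mat_index[OF P P ij] by (intro sum.cong) simp_all
  thus "P $$ (i, j) = (\<Sum>k<n. P $$ (i, k) * cnj (P $$ (j, k)))" unfolding idem .
qed

lemma hermitian_diff:
  assumes M: "M \<in> carrier_mat n n" and N: "N \<in> carrier_mat n n" and "hermitian_mat M" "hermitian_mat N"
  shows "hermitian_mat (M - N)"
proof -
  have c: "M - N \<in> carrier_mat n n" using N by (rule minus_carrier_mat)
  show ?thesis unfolding hermitian_mat_iff[OF c]
  proof (intro allI impI)
    fix i j assume ij: "i < n" "j < n"
    have "M $$ (j, i) = cnj (M $$ (i, j))" "N $$ (j, i) = cnj (N $$ (i, j))"
      using assms(3,4) ij unfolding hermitian_mat_iff[OF M] hermitian_mat_iff[OF N] by blast+
    moreover have "(M - N) $$ (j, i) = M $$ (j, i) - N $$ (j, i)" "(M - N) $$ (i, j) = M $$ (i, j) - N $$ (i, j)"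
      using M N ij by simp_all
    ultimately show "(M - N) $$ (j, i) = cnj ((M - N) $$ (i, j))" by (simp only: complex_cnj_diff)
  qed
qed

text \<open>The complement 1 - P is again a Hermitian idempotent. Projections can therefore serve as
  tests whose value changes by at most the trace norm of a perturbation.\<close>

lemma dominates_one_projection:
  assumes P: "P \<in> carrier_mat n n" and h: "hermitian_mat P" and idem: "P * P = P"
  shows "dominates n (1\<^sub>m n) P"
proof -
  have c: "1\<^sub>m n - P \<in> carrier_mat n n" using P by (rule minus_carrier_mat)
  have "(1\<^sub>m n - P) * (1\<^sub>m n - P) = 1\<^sub>m n * (1\<^sub>m n - P) - P * (1\<^sub>m n - P)"
    by (rule minus_mult_distrib_mat[OF one_carrier_mat P c])
  also have "P * (1\<^sub>m n - P) = P * 1\<^sub>m n - P * P"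
    by (rule mult_minus_distrib_mat[OF P one_carrier_mat P])
  also have "\<dots> = 0\<^sub>m n n" unfolding idem right_mult_one_mat[OF P] by (rule eq_matI) (use P in auto)
  also have "1\<^sub>m n * (1\<^sub>m n - P) = 1\<^sub>m n - P" by (rule left_mult_one_mat[OF c])
  also have "1\<^sub>m n - P - 0\<^sub>m n n = 1\<^sub>m n - P" by (rule eq_matI) (use P in auto)
  finally have "psd (1\<^sub>m n - P)"
    by (rule psd_projection[OF c hermitian_diff[OF one_carrier_mat P psd_imp_hermitian[OF psd_one] h]])
  moreover have "psd (1\<^sub>m n + P)"
    by (rule psd_add[OF psd_one psd_projection[OF assms] one_carrier_mat P])
  ultimately show ?thesis using P by (simp add: dominates_def)
qed

lemma hs_prod_eq_mtrace:
  assumes "M \<in> carrier_mat n n" "N \<in> carrier_mat n n"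
  shows "hs_prod n M N = mtrace (M * N)"
  unfolding hs_prod_def mtrace_def
  by (rule sum.cong) (use assms mult_mat_index[OF assms] in auto)

section \<open>Orthogonal projections and supports\<close>

lemma hermitian_cscalar_prod:
  assumes P: "P \<in> carrier_mat n n" and h: "hermitian_mat P" and v: "v \<in> carrier_vec n" and w: "w \<in> carrier_vec n"
  shows "(P *\<^sub>v v) \<bullet>c w = v \<bullet>c (P *\<^sub>v w)"
proof -
  have "(P *\<^sub>v v) \<bullet>c w = (\<Sum>i<n. \<Sum>j<n. P $$ (i, j) * v $ j * cnj (w $ i))"
    unfolding cscalar_prod_index[OF w] sum_distrib_right[symmetric]
    by (intro sum.cong refl) (simp only: lessThan_iff mult_mat_vec_index[OF P v])
  also have "\<dots> = (\<Sum>j<n. \<Sum>i<n. P $$ (i, j) * v $ j * cnj (w $ i))" by (rule sum.swap)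
  also have "\<dots> = (\<Sum>j<n. v $ j * cnj (\<Sum>i<n. P $$ (j, i) * w $ i))"
    unfolding cnj_sum sum_distrib_left
  proof (intro sum.cong refl)
    fix i j assume "i \<in> {..<n}" "j \<in> {..<n}"
    hence "P $$ (i, j) = cnj (P $$ (j, i))" using h unfolding hermitian_mat_iff[OF P] by blast
    thus "P $$ (i, j) * v $ j * cnj (w $ i) = v $ j * cnj (P $$ (j, i) * w $ i)" by (simp add: mult_ac)
  qed
  also have "\<dots> = v \<bullet>c (P *\<^sub>v w)"
    unfolding cscalar_prod_index[OF mult_mat_vec_carrier[OF P w]]
    by (intro sum.cong refl) (simp only: lessThan_iff mult_mat_vec_index[OF P w])
  finally show ?thesis .
qed

lemma projection_absorb:
  fixes P Q :: "complex mat"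
  assumes P: "P \<in> carrier_mat n n" "P * P = P" and Q: "Q \<in> carrier_mat n n"
    and ran: "(\<lambda>v. Q *\<^sub>v v) ` carrier_vec n \<subseteq> (\<lambda>v. P *\<^sub>v v) ` carrier_vec n"
  shows "P * Q = Q"
proof (rule mat_col_eqI)
  fix j assume "j < dim_col Q"
  hence j: "j < n" using Q by simp
  have "col Q j = Q *\<^sub>v col (1\<^sub>m n) j"
    using col_mult2[OF Q one_carrier_mat j] unfolding right_mult_one_mat[OF Q] .
  moreover have "col (1\<^sub>m n :: complex mat) j \<in> carrier_vec n" using j by simp
  ultimately have "col Q j \<in> (\<lambda>v. P *\<^sub>v v) ` carrier_vec n" using ran by auto
  then obtain y where y: "y \<in> carrier_vec n" "col Q j = P *\<^sub>v y" by (elim imageE)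
  have "col (P * Q) j = P *\<^sub>v (P *\<^sub>v y)" using col_mult2[OF P(1) Q j] y(2) by simp
  also have "\<dots> = P * P *\<^sub>v y" by (rule assoc_mult_mat_vec[OF P(1) P(1) y(1), symmetric])
  finally show "col (P * Q) j = col Q j" unfolding P(2) y(2) .
qed (use P Q in auto)

text \<open>Each projection fixes the range of the other, so PQ = Q and QP = P; taking adjoints in
  the first equation turns it into QP = Q.\<close>

lemma projection_unique:
  assumes P: "P \<in> carrier_mat n n" "hermitian_mat P" "P * P = P"
    and Q: "Q \<in> carrier_mat n n" "hermitian_mat Q" "Q * Q = Q"
    and ran: "(\<lambda>v. Q *\<^sub>v v) ` carrier_vec n = (\<lambda>v. P *\<^sub>v v) ` carrier_vec n"
  shows "P = Q"
proof -
  have PQ: "P * Q = Q" by (rule projection_absorb[OF P(1,3) Q(1)]) (simp add: ran)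
  have QP: "Q * P = P" by (rule projection_absorb[OF Q(1,3) P(1)]) (simp add: ran)
  have "Q = mat_adjoint (P * Q)" unfolding PQ using Q(2) by (simp add: hermitian_mat_def)
  also have "\<dots> = mat_adjoint Q * mat_adjoint P" by (rule mat_adjoint_mult[OF P(1) Q(1)])
  also have "\<dots> = Q * P" using P(2) Q(2) by (simp add: hermitian_mat_def)
  finally show ?thesis unfolding QP by (rule sym)
qed

text \<open>\<open>support_proj\<close> is a definite description, so a witness and its uniqueness
  are both required. The witness keeps the eigenbasis and replaces each nonzero eigenvalue by
  1.\<close>

lemma support_proj_spectral_mat:
  assumes U: "unitary_mat n U"
  shows "support_proj (spectral_mat n U d) = spectral_mat n U (\<lambda>k. if d k = 0 then 0 else 1)"
proof -
  define M where "M = spectral_mat n U d"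
  define e where "e k = (if d k = 0 then 0 else 1::real)" for k
  define P where "P = spectral_mat n U e"
  have Uc: "U \<in> carrier_mat n n" using U by (simp add: unitary_mat_def)
  have M: "M \<in> carrier_mat n n" and P: "P \<in> carrier_mat n n" using Uc by (simp_all add: M_def P_def)
  have hP: "hermitian_mat P" unfolding P_def by (rule hermitian_spectral_mat[OF Uc])
  have PP: "P * P = P" unfolding P_def spectral_mat_mult[OF U] by (rule arg_cong[of _ _ "spectral_mat n U"]) (auto simp: e_def)
  have MP: "M * P = M" unfolding P_def M_def spectral_mat_mult[OF U]
    by (rule arg_cong[of _ _ "spectral_mat n U"]) (auto simp: e_def)
  \<comment> \<open>The pseudo-inverse of \<open>M\<close>: since 1 / 0 = 0, the product
    \<open>E * M\<close> has eigenvalue 0 where \<open>d\<close> vanishes and 1 elsewhere. Hence the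
    kernel of \<open>M\<close> lies in that of \<open>P\<close>.\<close>
  define E where "E = spectral_mat n U (\<lambda>k. 1 / d k)"
  have E: "E \<in> carrier_mat n n" using Uc by (simp add: E_def)
  have EM: "E * M = P" unfolding P_def M_def E_def spectral_mat_mult[OF U]
    by (rule arg_cong[of _ _ "spectral_mat n U"]) (auto simp: e_def)
  have ker: "P *\<^sub>v w = 0\<^sub>v n" if w: "w \<in> carrier_vec n" "M *\<^sub>v w = 0\<^sub>v n" for w
  proof -
    have "P *\<^sub>v w = E *\<^sub>v (M *\<^sub>v w)" unfolding EM[symmetric] by (rule assoc_mult_mat_vec[OF E M w(1)])
    also have "\<dots> = 0\<^sub>v n" unfolding w(2) by (rule eq_vecI) (use E in auto)
    finally show ?thesis .
  qed
  have orth: "(P *\<^sub>v x) \<bullet>c w = 0" if x: "x \<in> carrier_vec n" and w: "w \<in> carrier_vec n" "M *\<^sub>v w = 0\<^sub>v n" for x w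
    unfolding hermitian_cscalar_prod[OF P hP x w(1)] ker[OF w] using cscalar_prod_index[of "0\<^sub>v n" n x] by simp
  have supp: "support M = {v \<in> carrier_vec n. \<forall>w \<in> carrier_vec n. M *\<^sub>v w = 0\<^sub>v n \<longrightarrow> v \<bullet>c w = 0}"
    using M by (auto simp: support_def mat_kernel_def)
  have ran: "(\<lambda>v. P *\<^sub>v v) ` carrier_vec n = support M"
  proof
    show "(\<lambda>v. P *\<^sub>v v) ` carrier_vec n \<subseteq> support M"
      unfolding supp using orth mult_mat_vec_carrier[OF P] by blast
    show "support M \<subseteq> (\<lambda>v. P *\<^sub>v v) ` carrier_vec n"
    proof
      fix v assume "v \<in> support M"
      hence v: "v \<in> carrier_vec n" and vk: "\<And>w. w \<in> carrier_vec n \<Longrightarrow> M *\<^sub>v w = 0\<^sub>v n \<Longrightarrow> v \<bullet>c w = 0"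
        unfolding supp by blast+
      have Pv: "P *\<^sub>v v \<in> carrier_vec n" by (rule mult_mat_vec_carrier[OF P v])
      \<comment> \<open>As MP = M, this difference lies in the kernel of \<open>M\<close>. It is
        therefore orthogonal both to \<open>v\<close> and to the range of \<open>P\<close>, hence to
        itself.\<close>
      define w where "w = v - P *\<^sub>v v"
      have w: "w \<in> carrier_vec n" unfolding w_def using v Pv by simp
      have "M *\<^sub>v w = M *\<^sub>v v - M *\<^sub>v (P *\<^sub>v v)"
        unfolding w_def by (rule mult_minus_distrib_mat_vec[OF M v Pv])
      also have "M *\<^sub>v (P *\<^sub>v v) = M *\<^sub>v v"
        unfolding assoc_mult_mat_vec[OF M P v, symmetric] MP ..
      finally have Mw: "M *\<^sub>v w = 0\<^sub>v n" using mult_mat_vec_carrier[OF M v] by simp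
      have wi: "w $ i = v $ i - (P *\<^sub>v v) $ i" if "i < n" for i using that P v by (simp add: w_def)
      have "w \<bullet>c w = (\<Sum>i<n. v $ i * cnj (w $ i)) - (\<Sum>i<n. (P *\<^sub>v v) $ i * cnj (w $ i))"
        unfolding cscalar_prod_index[OF w] sum_subtractf[symmetric]
        by (intro sum.cong refl) (simp only: lessThan_iff wi left_diff_distrib)
      also have "\<dots> = v \<bullet>c w - (P *\<^sub>v v) \<bullet>c w" unfolding cscalar_prod_index[OF w] ..
      also have "\<dots> = 0" unfolding vk[OF w Mw] orth[OF v w Mw] by simp
      finally have "w = 0\<^sub>v n" using conjugate_square_eq_0_vec[OF w] by simp
      have "v = P *\<^sub>v v"
      proof (rule eq_vecI)
        fix i assume "i < dim_vec (P *\<^sub>v v)"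
        hence i: "i < n" using P by simp
        have "w $ i = 0" unfolding \<open>w = 0\<^sub>v n\<close> using i by simp
        thus "v $ i = (P *\<^sub>v v) $ i" unfolding wi[OF i] by simp
      qed (use P v in simp)
      thus "v \<in> (\<lambda>v. P *\<^sub>v v) ` carrier_vec n" using v by (rule image_eqI)
    qed
  qed
  have dimM: "dim_col M = n" using M by simp
  have "support_proj M = P"
    unfolding support_proj_def dimM
  proof (rule the_equality)
    show "P \<in> carrier_mat n n \<and> hermitian_mat P \<and> P * P = P \<and> (\<lambda>v. P *\<^sub>v v) ` carrier_vec n = support M"
      using P hP PP ran by (intro conjI)
  next
    fix Q assume Q: "Q \<in> carrier_mat n n \<and> hermitian_mat Q \<and> Q * Q = Q \<and> (\<lambda>v. Q *\<^sub>v v) ` carrier_vec n = support M"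
    show "Q = P"
      by (rule projection_unique[of _ n]) (use Q P hP PP ran in auto)
  qed
  thus ?thesis by (simp add: M_def P_def e_def[abs_def])
qed

text \<open>The last identity shows that a state has full weight on its support projection, the
  starting value in \<open>dilution_bound\<close>.\<close>

lemma support_proj_projection:
  assumes "M \<in> carrier_mat n n" "hermitian_mat M"
  shows "support_proj M \<in> carrier_mat n n" "hermitian_mat (support_proj M)"
    "support_proj M * support_proj M = support_proj M" "support_proj M * M = M"
proof -
  obtain U d where U: "unitary_mat n U" and M: "M = spectral_mat n U d"
    using spectral_theorem[OF assms] by (elim exE conjE)
  have Uc: "U \<in> carrier_mat n n" using U by (simp add: unitary_mat_def)
  show "support_proj M \<in> carrier_mat n n" "hermitian_mat (support_proj M)"
    unfolding M support_proj_spectral_mat[OF U] by (rule spectral_mat_carrier[OF Uc] hermitian_spectral_mat[OF Uc])+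
  show "support_proj M * support_proj M = support_proj M" "support_proj M * M = M"
    unfolding M support_proj_spectral_mat[OF U] spectral_mat_mult[OF U]
    by (rule arg_cong[of _ _ "spectral_mat n U"], rule ext, simp)+
qed

section \<open>The Bell state and its tensor powers\<close>

lemma sum_lessThan_4: "(\<Sum>l<(4::nat). f l) = f 0 + f 1 + f 2 + (f 3 :: 'a::comm_monoid_add)"
  by (simp add: eval_nat_numeral)

lemma less_4_cases: "(i::nat) < 4 \<Longrightarrow> i = 0 \<or> i = 1 \<or> i = 2 \<or> i = 3"
  by arith

lemma bell_state_carrier [simp]: "bell_state \<in> carrier_mat (2 * 2) (2 * 2)"
  by (simp add: bell_state_def)

lemma bell_state_index:
  assumes "r < 4" "c < 4"
  shows "bell_state $$ (r, c) = (if (r = 0 \<or> r = 3) \<and> (c = 0 \<or> c = 3) then 1 / 2 else 0)"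
proof -
  have v: "bell_vec $ i = (if i = 0 \<or> i = 3 then of_real (1 / sqrt 2) else 0)" if "i < 4" for i
    using less_4_cases[OF that] by (auto simp: bell_vec_def vec_of_list_index eval_nat_numeral)
  have "complex_of_real (1 / sqrt 2) * of_real (1 / sqrt 2) = of_real (1 / sqrt 2 * (1 / sqrt 2))"
    by (rule of_real_mult[symmetric])
  also have "1 / sqrt 2 * (1 / sqrt 2) = 1 / 2" by simp
  finally have s: "complex_of_real (1 / sqrt 2) * of_real (1 / sqrt 2) = 1 / 2" by simp
  have "bell_state $$ (r, c) = bell_vec $ r * cnj (bell_vec $ c)" using assms by (simp add: bell_state_def)
  thus ?thesis unfolding v[OF assms(1)] v[OF assms(2)] using s by (simp del: of_real_divide)
qed

lemma bell_state_hermitian: "hermitian_mat bell_state"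
  unfolding hermitian_mat_iff[OF bell_state_carrier] by (simp add: bell_state_index)

lemma bell_state_idempotent: "bell_state * bell_state = bell_state"
proof (rule eq_matI)
  fix i j assume "i < dim_row bell_state" "j < dim_col bell_state"
  hence ij: "i < 4" "j < 4" by (simp_all add: bell_state_def)
  have c: "bell_state \<in> carrier_mat 4 4" using bell_state_carrier by simp
  show "(bell_state * bell_state) $$ (i, j) = bell_state $$ (i, j)"
    unfolding mult_mat_index[OF c c ij] sum_lessThan_4 using ij by (simp add: bell_state_index)
qed (simp_all add: bell_state_def)

lemma psd_bell_state: "psd bell_state"
  by (rule psd_projection[OF bell_state_carrier bell_state_hermitian bell_state_idempotent])

lemma hs_prod_bell_state: "hs_prod (2 * 2) bell_state bell_state = 1"
proof -
  have "hs_prod (2 * 2) bell_state bell_state = mtrace bell_state"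
    by (simp only: hs_prod_eq_mtrace[OF bell_state_carrier bell_state_carrier] bell_state_idempotent)
  also have "\<dots> = (\<Sum>i<4. bell_state $$ (i, i))" by (simp add: mtrace_def bell_state_def)
  also have "\<dots> = 1" unfolding sum_lessThan_4 by (simp add: bell_state_index)
  finally show ?thesis .
qed

text \<open>The partial transpose of the Bell state is half of the swap operator, whose eigenvalues are \<open>1\<close> and \<open>-1\<close>.\<close>

lemma dominates_bell_partial_transpose:
  "dominates (2 * 2) (of_real (1 / 2) \<cdot>\<^sub>m 1\<^sub>m (2 * 2)) (partial_transpose 2 bell_state)"
proof -
  define F where "F = partial_transpose 2 bell_state"
  have F: "F \<in> carrier_mat 4 4" using partial_transpose_carrier[OF bell_state_carrier, of 2] by (simp add: F_def)
  have Fi: "F $$ (r, c) = (if (r = 0 \<and> c = 0) \<or> (r = 3 \<and> c = 3) \<or> (r = 1 \<and> c = 2) \<or> (r = 2 \<and> c = 1)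
      then 1 / 2 else 0)" if rc: "r < 4" "c < 4" for r c
  proof -
    have rc': "r < 2 * 2" "c < 2 * 2" using rc by simp_all
    show ?thesis
      unfolding F_def partial_transpose_index[OF bell_state_carrier rc']
      using less_4_cases[OF rc(1)] less_4_cases[OF rc(2)] by (elim disjE) (simp_all add: bell_state_index)
  qed
  define I :: "complex mat" where "I = of_real (1 / 2) \<cdot>\<^sub>m 1\<^sub>m 4"
  have I: "I \<in> carrier_mat 4 4" by (simp add: I_def)
  have Ii: "I $$ (r, c) = (if r = c then 1 / 2 else 0)" if "r < 4" "c < 4" for r c
    using that by (simp add: I_def)
  \<comment> \<open>Half of 1 - swap is the projection onto antisymmetric vectors, so its own
    columns are a Gram family; the same holds below for half of 1 + swap and the symmetric
    vectors.\<close>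
  have "psd (I - F)"
  proof (rule psd_gramI[where n = 4 and K = "{..<4}" and f = "\<lambda>k i. (I - F) $$ (i, k)"])
    fix i j :: nat assume ij: "i < 4" "j < 4"
    show "(I - F) $$ (i, j) = (\<Sum>k<4. (I - F) $$ (i, k) * cnj ((I - F) $$ (j, k)))"
      unfolding sum_lessThan_4 using less_4_cases[OF ij(1)] less_4_cases[OF ij(2)] F I
      by (elim disjE) (simp_all add: Fi Ii)
  qed (use F in \<open>rule minus_carrier_mat\<close>)
  moreover have "psd (I + F)"
  proof (rule psd_gramI[where n = 4 and K = "{..<4}" and f = "\<lambda>k i. (I + F) $$ (i, k)"])
    fix i j :: nat assume ij: "i < 4" "j < 4"
    show "(I + F) $$ (i, j) = (\<Sum>k<4. (I + F) $$ (i, k) * cnj ((I + F) $$ (j, k)))"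
      unfolding sum_lessThan_4 using less_4_cases[OF ij(1)] less_4_cases[OF ij(2)] F I
      by (elim disjE) (simp_all add: Fi Ii)
  qed (use F I in simp)
  ultimately show ?thesis using F I by (simp add: dominates_def F_def I_def)
qed

lemma dominates_bell_power:
  "dominates (2 ^ m * 2 ^ m) (1\<^sub>m (2 ^ m * 2 ^ m)) (bi_power 2 2 bell_state m)"
proof -
  have one: "1 \<cdot>\<^sub>m 1\<^sub>m k = (1\<^sub>m k :: complex mat)" for k by (rule eq_matI) auto
  show ?thesis
    using dominates_bi_power[OF dominates_one_projection[OF bell_state_carrier bell_state_hermitian
      bell_state_idempotent], of m] bi_power_one[of 2 2 1 m] by (simp add: one)
qed

text \<open>Compared with \<open>dominates_bell_power\<close>, transposition improves the constant
  from 1 to 2^(-m). Every occurrence of \<open>m\<close> in the exponents of the two bounds below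
  goes back to this gain.\<close>

lemma dominates_bell_power_partial_transpose:
  "dominates (2 ^ m * 2 ^ m) (of_real ((1 / 2) ^ m) \<cdot>\<^sub>m 1\<^sub>m (2 ^ m * 2 ^ m))
    (partial_transpose (2 ^ m) (bi_power 2 2 bell_state m))"
  using dominates_bi_power[OF dominates_bell_partial_transpose, of m]
  unfolding bi_power_one partial_transpose_bi_power[OF bell_state_carrier] by (simp only: of_real_power)

section \<open>Distillation and dilution\<close>

text \<open>Partial transposition preserves the trace, so the transposed map \<open>L'\<close>
  inherits trace preservation from \<open>L\<close>. The last claim, a consequence of involutivity,
  pushes the transpose through \<open>L\<close> at the price of replacing it by
  \<open>L'\<close>.\<close>

lemma ppt_operation_maps:
  assumes "ppt_operation a b a' b' L"
  defines "L' \<equiv> partial_transpose b' \<circ> L \<circ> partial_transpose b"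
  shows "completely_positive (a * b) (a' * b') L" "completely_positive (a * b) (a' * b') L'"
    "linear_map (a * b) (a' * b') L" "linear_map (a * b) (a' * b') L'"
    "M \<in> carrier_mat (a * b) (a * b) \<Longrightarrow> L M \<in> carrier_mat (a' * b') (a' * b')"
    "M \<in> carrier_mat (a * b) (a * b) \<Longrightarrow> mtrace (L M) = mtrace M"
    "M \<in> carrier_mat (a * b) (a * b) \<Longrightarrow> mtrace (L' M) = mtrace M"
    "M \<in> carrier_mat (a * b) (a * b) \<Longrightarrow> partial_transpose b' (L M) = L' (partial_transpose b M)"
proof -
  show cp: "completely_positive (a * b) (a' * b') L" and cp': "completely_positive (a * b) (a' * b') L'"
    using assms by (simp_all add: ppt_operation_def)
  show lin: "linear_map (a * b) (a' * b') L" and "linear_map (a * b) (a' * b') L'"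
    using cp cp' by (simp_all add: completely_positive_def)
  have tp: "mtrace (L M) = mtrace M" if "M \<in> carrier_mat (a * b) (a * b)" for M
    using assms(1) that by (simp add: ppt_operation_def trace_preserving_def)
  have Lc: "L M \<in> carrier_mat (a' * b') (a' * b')" if "M \<in> carrier_mat (a * b) (a * b)" for M
    using lin that by (simp add: linear_map_def)
  assume M: "M \<in> carrier_mat (a * b) (a * b)"
  have ptM: "partial_transpose b M \<in> carrier_mat (a * b) (a * b)" using M by simp
  show "L M \<in> carrier_mat (a' * b') (a' * b')" by (rule Lc[OF M])
  show "mtrace (L M) = mtrace M" by (rule tp[OF M])
  have "square_mat (L (partial_transpose b M))" "square_mat M" using Lc[OF ptM] M by auto
  thus "mtrace (L' M) = mtrace M" by (simp add: L'_def mtrace_partial_transpose tp[OF ptM])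
  show "partial_transpose b' (L M) = L' (partial_transpose b M)"
    by (simp add: L'_def partial_transpose_involution[OF M])
qed

lemma psd_bi_power:
  assumes "psd M" "M \<in> carrier_mat (a * b) (a * b)"
  shows "psd (bi_power a b M n)"
  using dominates_imp_psd[OF dominates_bi_power[OF dominates_self[OF assms]]] .

text \<open>The overlap with the target projection is the test: a small trace distance forces it
  close to 1, while transposing both factors makes it small in \<open>m\<close>.\<close>

lemma distillation_bound:
  assumes \<rho>: "state (a * b) \<rho>"
    and X: "X \<in> carrier_mat (a * b) (a * b)" "hermitian_mat X" "loewner_le \<rho> X"
    and L: "ppt_operation (a ^ n) (b ^ n) (2 ^ m) (2 ^ m) L"
  shows "1 - trace_norm (L (bi_power a b \<rho> n) - bi_power 2 2 bell_state m)
    \<le> trace_norm (partial_transpose b X) ^ n * (1 / 2) ^ m"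
proof -
  define d where "d = a ^ n * b ^ n"
  define e :: nat where "e = 2 ^ m * 2 ^ m"
  define \<rho>n where "\<rho>n = bi_power a b \<rho> n"
  define Xn where "Xn = bi_power a b X n"
  define \<Phi> where "\<Phi> = bi_power 2 2 bell_state m"
  define L' where "L' = partial_transpose (2 ^ m) \<circ> L \<circ> partial_transpose (b ^ n)"
  define \<epsilon> where "\<epsilon> = trace_norm (L \<rho>n - \<Phi>)"
  note Lp = ppt_operation_maps[OF L, folded d_def e_def L'_def]
  have \<rho>': "\<rho> \<in> carrier_mat (a * b) (a * b)" "psd \<rho>" using \<rho> by (simp_all add: state_def)
  have c: "\<rho>n \<in> carrier_mat d d" "Xn \<in> carrier_mat d d" "\<Phi> \<in> carrier_mat e e"
    unfolding \<rho>n_def Xn_def d_def \<Phi>_def e_def by (rule bi_power_carrier)+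
  \<comment> \<open>Here X + \<rho> = (X - \<rho>) + 2 \<rho>, so positivity of \<rho> upgrades the
    one-sided bound to domination, which tensor powers respect.\<close>
  have dX: "dominates (a * b) X \<rho>"
  proof -
    have X\<rho>: "psd (X - \<rho>)" using X(3) by (simp add: loewner_le_def)
    have cX\<rho>: "X - \<rho> \<in> carrier_mat (a * b) (a * b)" by (rule minus_carrier_mat[OF \<rho>'(1)])
    have "psd (X - \<rho> + (\<rho> + \<rho>))"
      by (rule psd_add[OF X\<rho> psd_add[OF \<rho>'(2,2,1,1)] cX\<rho>]) (use \<rho>'(1) in simp)
    also have "X - \<rho> + (\<rho> + \<rho>) = X + \<rho>" by (rule eq_matI) (use X(1) \<rho>'(1) in auto)
    finally show ?thesis using X(1) \<rho>'(1) X\<rho> by (simp add: dominates_def)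
  qed
  have diff: "psd (Xn - \<rho>n)"
    using dominates_bi_power[OF dX, of n] by (simp add: dominates_def Xn_def \<rho>n_def)
  have L\<rho>: "psd (L \<rho>n)" "L \<rho>n \<in> carrier_mat e e"
    using completely_positive_psd[OF Lp(1) c(1)] psd_bi_power[OF \<rho>'(2,1)] Lp(5)[OF c(1)] by (simp_all add: \<rho>n_def)
  have LX: "L Xn \<in> carrier_mat e e" by (rule Lp(5)[OF c(2)])
  have psd\<Phi>: "psd \<Phi>" unfolding \<Phi>_def by (rule psd_bi_power[OF psd_bell_state bell_state_carrier])
  have cD: "L \<rho>n - \<Phi> \<in> carrier_mat e e" by (rule minus_carrier_mat[OF c(3)])
  have "hermitian_mat (L \<rho>n - \<Phi>)"
    by (rule hermitian_diff[OF L\<rho>(2) c(3) psd_imp_hermitian[OF L\<rho>(1)] psd_imp_hermitian[OF psd\<Phi>]])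
  \<comment> \<open>\<open>T\<close> stands for the absolute value of the error. Pairing it with the
    identity, which dominates the target, bounds the loss of overlap by its trace.\<close>
  then obtain T where T: "dominates e T (L \<rho>n - \<Phi>)" "mtrace T = of_real \<epsilon>"
    using trace_norm_dominates[OF cD] unfolding \<epsilon>_def by blast
  have Tc: "T \<in> carrier_mat e e" using T(1) by (simp add: dominates_def)
  have "\<bar>Re (hs_prod e \<Phi> (L \<rho>n - \<Phi>))\<bar> \<le> Re (hs_prod e (1\<^sub>m e) T)"
    using hs_prod_dominates[OF dominates_bell_power[of m, folded e_def \<Phi>_def] T(1)] .
  also have "\<dots> = \<epsilon>" by (simp add: hs_prod_commute[of e "1\<^sub>m e"] hs_prod_one[OF Tc] T(2))
  finally have 1: "\<bar>Re (hs_prod e \<Phi> (L \<rho>n)) - Re (hs_prod e \<Phi> \<Phi>)\<bar> \<le> \<epsilon>"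
    by (simp add: hs_prod_diff[OF L\<rho>(2) c(3)])
  have 2: "hs_prod e \<Phi> \<Phi> = 1"
    unfolding e_def \<Phi>_def hs_prod_bi_power hs_prod_bell_state by simp
  have "0 \<le> Re (hs_prod e \<Phi> (L (Xn - \<rho>n)))"
  proof (rule hs_prod_psd_nonneg[OF psd\<Phi> _ c(3)])
    have "Xn - \<rho>n \<in> carrier_mat d d" by (rule minus_carrier_mat[OF c(1)])
    thus "psd (L (Xn - \<rho>n))" "L (Xn - \<rho>n) \<in> carrier_mat e e"
      using completely_positive_psd[OF Lp(1) _ diff] Lp(5) by blast+
  qed
  hence 3: "Re (hs_prod e \<Phi> (L \<rho>n)) \<le> Re (hs_prod e \<Phi> (L Xn))"
    unfolding linear_map_diff[OF Lp(3) c(2,1)] hs_prod_diff[OF LX L\<rho>(2)] by simp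
  define w where "w = trace_norm (partial_transpose b X)"
  obtain R where R: "dominates (a * b) R (partial_transpose b X)" "mtrace R = of_real w"
    using trace_norm_dominates[OF partial_transpose_carrier[OF X(1)] partial_transpose_hermitian[OF X(1,2)]]
    unfolding w_def by blast
  have Rc: "R \<in> carrier_mat (a * b) (a * b)" using R(1) by (simp add: dominates_def)
  define Rn where "Rn = bi_power a b R n"
  have Rn: "Rn \<in> carrier_mat d d" unfolding Rn_def d_def by (rule bi_power_carrier)
  have Rn_dom: "dominates d Rn (partial_transpose (b ^ n) Xn)"
    unfolding d_def Rn_def Xn_def partial_transpose_bi_power[OF X(1)] by (rule dominates_bi_power[OF R(1)])
  have LR: "dominates e (L' Rn) (L' (partial_transpose (b ^ n) Xn))"
    by (rule dominates_completely_positive[OF Lp(2) Rn_dom])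
  have LRc: "L' Rn \<in> carrier_mat e e" using LR by (simp add: dominates_def)
  \<comment> \<open>After transposition the first factor is dominated by 2^(-m) times the identity
    and the second by \<open>L' Rn\<close>, whose trace is \<open>w ^ n\<close>; the pairing of
    these two dominating matrices is the claimed bound.\<close>
  have "hs_prod e \<Phi> (L Xn) = hs_prod e (partial_transpose (2 ^ m) \<Phi>) (partial_transpose (2 ^ m) (L Xn))"
    using hs_prod_partial_transpose[of \<Phi> "2 ^ m" "2 ^ m" "L Xn"] c(3) LX unfolding e_def by simp
  also have "\<dots> = hs_prod e (partial_transpose (2 ^ m) \<Phi>) (L' (partial_transpose (b ^ n) Xn))"
    unfolding Lp(8)[OF c(2)] ..
  finally have "Re (hs_prod e \<Phi> (L Xn)) \<le> Re (hs_prod e (of_real ((1 / 2) ^ m) \<cdot>\<^sub>m 1\<^sub>m e) (L' Rn))"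
    using hs_prod_dominates[OF dominates_bell_power_partial_transpose[of m, folded e_def \<Phi>_def] LR] by simp
  also have "hs_prod e (of_real ((1 / 2) ^ m) \<cdot>\<^sub>m 1\<^sub>m e) (L' Rn) = of_real ((1 / 2) ^ m) * mtrace (L' Rn)"
    unfolding hs_prod_commute[of e _ "L' Rn"] hs_prod_smult[OF one_carrier_mat] hs_prod_one[OF LRc] ..
  also have "mtrace (L' Rn) = of_real (w ^ n)"
    unfolding Lp(7)[OF Rn] unfolding Rn_def mtrace_bi_power[OF Rc] R(2) by simp
  finally have "Re (hs_prod e \<Phi> (L Xn)) \<le> w ^ n * (1 / 2) ^ m"
    unfolding of_real_mult[symmetric] Re_complex_of_real by (simp only: mult.commute)
  hence "1 - \<epsilon> \<le> w ^ n * (1 / 2) ^ m" using 1 2 3 by simp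
  thus ?thesis unfolding \<epsilon>_def w_def \<rho>n_def \<Phi>_def .
qed

text \<open>The test is the n-fold support projection, on which the n-fold power of \<rho> has
  weight 1. After transposition, \<open>Yn\<close> dominates the test and a multiple of
  \<open>L'\<close> at the identity dominates the output.\<close>

lemma dilution_bound:
  assumes \<rho>: "state (a * b) \<rho>"
    and Y: "Y \<in> carrier_mat (a * b) (a * b)" "hermitian_mat Y"
      "loewner_le (- Y) (partial_transpose b (support_proj \<rho>))"
      "loewner_le (partial_transpose b (support_proj \<rho>)) Y"
    and L: "ppt_operation (2 ^ m) (2 ^ m) (a ^ n) (b ^ n) L"
  shows "1 - trace_norm (bi_power a b \<rho> n - L (bi_power 2 2 bell_state m))
    \<le> op_norm (partial_transpose b Y) ^ n * 2 ^ m"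
proof -
  define d where "d = a ^ n * b ^ n"
  define e :: nat where "e = 2 ^ m * 2 ^ m"
  define \<rho>n where "\<rho>n = bi_power a b \<rho> n"
  define \<Phi> where "\<Phi> = bi_power 2 2 bell_state m"
  define L' where "L' = partial_transpose (b ^ n) \<circ> L \<circ> partial_transpose (2 ^ m)"
  define \<epsilon> where "\<epsilon> = trace_norm (\<rho>n - L \<Phi>)"
  define P where "P = support_proj \<rho>"
  define Pn where "Pn = bi_power a b P n"
  define Yn where "Yn = bi_power a b Y n"
  note Lp = ppt_operation_maps[OF L, folded d_def e_def L'_def]
  have \<rho>': "\<rho> \<in> carrier_mat (a * b) (a * b)" "psd \<rho>" "mtrace \<rho> = 1" using \<rho> by (simp_all add: state_def)
  note P = support_proj_projection[OF \<rho>'(1) psd_imp_hermitian[OF \<rho>'(2)], folded P_def]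
  have c: "\<rho>n \<in> carrier_mat d d" "Pn \<in> carrier_mat d d" "Yn \<in> carrier_mat d d" "\<Phi> \<in> carrier_mat e e"
    unfolding \<rho>n_def Pn_def Yn_def d_def \<Phi>_def e_def by (rule bi_power_carrier)+
  have one: "1 \<cdot>\<^sub>m 1\<^sub>m k = (1\<^sub>m k :: complex mat)" for k by (rule eq_matI) auto
  have domP: "dominates d (1\<^sub>m d) Pn"
    using dominates_bi_power[OF dominates_one_projection[OF P(1-3)], of n] bi_power_one[of a b 1 n]
    by (simp add: one d_def Pn_def)
  have psd\<Phi>: "psd \<Phi>" unfolding \<Phi>_def by (rule psd_bi_power[OF psd_bell_state bell_state_carrier])
  have L\<Phi>: "psd (L \<Phi>)" "L \<Phi> \<in> carrier_mat d d"
    using completely_positive_psd[OF Lp(1) c(4) psd\<Phi>] Lp(5)[OF c(4)] by simp_all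
  have psd\<rho>n: "psd \<rho>n" unfolding \<rho>n_def by (rule psd_bi_power[OF \<rho>'(2,1)])
  have cD: "\<rho>n - L \<Phi> \<in> carrier_mat d d" by (rule minus_carrier_mat[OF L\<Phi>(2)])
  have "hermitian_mat (\<rho>n - L \<Phi>)"
    by (rule hermitian_diff[OF c(1) L\<Phi>(2) psd_imp_hermitian[OF psd\<rho>n] psd_imp_hermitian[OF L\<Phi>(1)]])
  then obtain T where T: "dominates d T (\<rho>n - L \<Phi>)" "mtrace T = of_real \<epsilon>"
    using trace_norm_dominates[OF cD] unfolding \<epsilon>_def by blast
  have Tc: "T \<in> carrier_mat d d" using T(1) by (simp add: dominates_def)
  have "\<bar>Re (hs_prod d Pn (\<rho>n - L \<Phi>))\<bar> \<le> Re (hs_prod d (1\<^sub>m d) T)"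
    by (rule hs_prod_dominates[OF domP T(1)])
  also have "\<dots> = \<epsilon>" by (simp add: hs_prod_commute[of d "1\<^sub>m d"] hs_prod_one[OF Tc] T(2))
  finally have 1: "\<bar>Re (hs_prod d Pn \<rho>n) - Re (hs_prod d Pn (L \<Phi>))\<bar> \<le> \<epsilon>"
    by (simp add: hs_prod_diff[OF c(1) L\<Phi>(2)])
  have 2: "hs_prod d Pn \<rho>n = 1"
    unfolding d_def Pn_def \<rho>n_def hs_prod_bi_power hs_prod_eq_mtrace[OF P(1) \<rho>'(1)] P(4) \<rho>'(3) by simp
  have ptP: "partial_transpose b P \<in> carrier_mat (a * b) (a * b)" by (rule partial_transpose_carrier[OF P(1)])
  have domY: "dominates (a * b) Y (partial_transpose b P)"
  proof -
    have "partial_transpose b P - (- Y) = Y + partial_transpose b P"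
      by (rule eq_matI) (use ptP Y(1) in auto)
    thus ?thesis using Y ptP by (simp add: dominates_def loewner_le_def P_def)
  qed
  have domYn: "dominates d Yn (partial_transpose (b ^ n) Pn)"
    unfolding d_def Yn_def Pn_def partial_transpose_bi_power[OF P(1)] by (rule dominates_bi_power[OF domY])
  \<comment> \<open>The constant that dominates the transposed Bell power.\<close>
  define h where "h = (1 / 2 :: real) ^ m"
  have h: "0 \<le> h" by (simp add: h_def)
  have domL: "dominates d (L' (of_real h \<cdot>\<^sub>m 1\<^sub>m e)) (L' (partial_transpose (2 ^ m) \<Phi>))"
    using dominates_completely_positive[OF Lp(2) dominates_bell_power_partial_transpose[of m, folded e_def \<Phi>_def]]
    unfolding h_def .
  have L1: "L (1\<^sub>m e) \<in> carrier_mat d d" "psd (L (1\<^sub>m e))"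
    using Lp(5)[OF one_carrier_mat] completely_positive_psd[OF Lp(1) one_carrier_mat psd_one] .
  have pt1: "partial_transpose (2 ^ m) (1\<^sub>m e) = 1\<^sub>m e" unfolding e_def by (rule partial_transpose_one)
  have L'1: "L' (1\<^sub>m e) = partial_transpose (b ^ n) (L (1\<^sub>m e))" using Lp(8)[OF one_carrier_mat] pt1 by simp
  have L'1c: "L' (1\<^sub>m e) \<in> carrier_mat d d" unfolding L'1 using L1(1) by simp
  have L'h: "L' (of_real h \<cdot>\<^sub>m 1\<^sub>m e) = of_real h \<cdot>\<^sub>m L' (1\<^sub>m e)"
    using Lp(4) by (simp add: linear_map_def)
  have "hs_prod d Pn (L \<Phi>) = hs_prod d (partial_transpose (b ^ n) Pn) (partial_transpose (b ^ n) (L \<Phi>))"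
    using hs_prod_partial_transpose[of Pn "a ^ n" "b ^ n" "L \<Phi>"] c(2) L\<Phi>(2) unfolding d_def by simp
  also have "\<dots> = hs_prod d (partial_transpose (b ^ n) Pn) (L' (partial_transpose (2 ^ m) \<Phi>))"
    unfolding Lp(8)[OF c(4)] ..
  finally have "Re (hs_prod d Pn (L \<Phi>)) \<le> Re (hs_prod d Yn (L' (of_real h \<cdot>\<^sub>m 1\<^sub>m e)))"
    using hs_prod_dominates[OF domYn domL] by simp
  also have "\<dots> = h * Re (hs_prod d Yn (L' (1\<^sub>m e)))"
    unfolding L'h hs_prod_smult[OF L'1c] by simp
  \<comment> \<open>The second transposition brings in the transpose of \<open>Y\<close>, whose
    operator norm occurs in \<open>E_eta\<close>, and restores the positive matrix \<open>L\<close>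
    at the identity, whose trace is known.\<close>
  also have "hs_prod d Yn (L' (1\<^sub>m e)) = hs_prod d (partial_transpose (b ^ n) Yn) (L (1\<^sub>m e))"
  proof -
    have "partial_transpose (b ^ n) (L' (1\<^sub>m e)) = L (1\<^sub>m e)"
      unfolding L'1 using L1(1) unfolding d_def by (rule partial_transpose_involution)
    moreover have "hs_prod d (partial_transpose (b ^ n) Yn) (partial_transpose (b ^ n) (L' (1\<^sub>m e)))
        = hs_prod d Yn (L' (1\<^sub>m e))"
      using c(3) L'1c unfolding d_def by (rule hs_prod_partial_transpose)
    ultimately show ?thesis by simp
  qed
  finally have 3: "Re (hs_prod d Pn (L \<Phi>)) \<le> h * Re (hs_prod d (partial_transpose (b ^ n) Yn) (L (1\<^sub>m e)))" .
  define y where "y = op_norm (partial_transpose b Y)"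
  have "dominates (a * b) (of_real y \<cdot>\<^sub>m 1\<^sub>m (a * b)) (partial_transpose b Y)"
    unfolding y_def by (rule op_norm_dominates[OF partial_transpose_carrier[OF Y(1)] partial_transpose_hermitian[OF Y(1,2)]])
  hence "dominates d (of_real y ^ n \<cdot>\<^sub>m 1\<^sub>m d) (partial_transpose (b ^ n) Yn)"
    unfolding Yn_def d_def partial_transpose_bi_power[OF Y(1)] bi_power_one[symmetric] by (rule dominates_bi_power)
  hence "\<bar>Re (hs_prod d (partial_transpose (b ^ n) Yn) (L (1\<^sub>m e)))\<bar> \<le> Re (hs_prod d (of_real y ^ n \<cdot>\<^sub>m 1\<^sub>m d) (L (1\<^sub>m e)))"
    using dominates_self[OF L1(2,1)] by (rule hs_prod_dominates)
  also have "hs_prod d (of_real y ^ n \<cdot>\<^sub>m 1\<^sub>m d) (L (1\<^sub>m e)) = of_real y ^ n * mtrace (L (1\<^sub>m e))"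
    unfolding hs_prod_commute[of d _ "L (1\<^sub>m e)"] hs_prod_smult[OF one_carrier_mat] hs_prod_one[OF L1(1)] ..
  also have "mtrace (L (1\<^sub>m e)) = of_nat e"
    unfolding Lp(6)[OF one_carrier_mat] by (simp add: mtrace_def)
  also have "of_real y ^ n * of_nat e = complex_of_real (y ^ n * real e)" by simp
  also have "Re (complex_of_real (y ^ n * real e)) = y ^ n * real e" by (rule Re_complex_of_real)
  finally have "h * Re (hs_prod d (partial_transpose (b ^ n) Yn) (L (1\<^sub>m e))) \<le> h * (y ^ n * real e)"
    using h by (intro mult_left_mono) simp_all
  \<comment> \<open>The identity on both halves of m Bell pairs has trace e = 4^m, and h =
    2^(-m).\<close>
  also have "h * (y ^ n * real e) = y ^ n * 2 ^ m"
    by (simp add: h_def e_def power_divide)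
  finally have "1 - \<epsilon> \<le> y ^ n * 2 ^ m" using 1 2 3 by simp
  thus ?thesis unfolding \<epsilon>_def y_def \<rho>n_def \<Phi>_def .
qed

section \<open>From bounds at fixed n to asymptotic rates\<close>

lemma power_bounded_below_imp_ge_1:
  fixes x \<delta> :: real
  assumes "0 \<le> x" "0 < \<delta>" "\<forall>\<^sub>F n in sequentially. \<delta> \<le> x ^ n"
  shows "1 \<le> x"
proof (rule ccontr)
  assume "\<not> 1 \<le> x"
  hence "(\<lambda>n. x ^ n) \<longlonglongrightarrow> 0" using assms(1) by (intro LIMSEQ_realpow_zero) auto
  hence "\<forall>\<^sub>F n in sequentially. x ^ n < \<delta>" using assms(2) by (rule order_tendstoD)
  hence "\<forall>\<^sub>F n in sequentially. False" using assms(3) by eventually_elim simp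
  thus False by simp
qed

lemma trace_norm_nonneg:
  assumes "M \<in> carrier_mat n n" "hermitian_mat M"
  shows "0 \<le> trace_norm M"
proof -
  obtain U d where "unitary_mat n U" "M = spectral_mat n U d"
    using spectral_theorem[OF assms] by (elim exE conjE)
  thus ?thesis by (simp add: trace_norm_spectral_mat sum_nonneg)
qed

text \<open>The infimum need not be attained, but once it is below \<open>\<delta>\<close> some
  member is. An empty \<open>S n\<close> has infinite infimum and is thereby excluded for large
  \<open>n\<close>.\<close>

lemma eventually_INF_less:
  fixes f :: "'a \<Rightarrow> nat \<Rightarrow> real"
  assumes "(\<lambda>n. INF L \<in> S n. ereal (f L n)) \<longlonglongrightarrow> 0" "0 < \<delta>"
  shows "\<forall>\<^sub>F n in sequentially. \<exists>L \<in> S n. f L n < \<delta>"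
proof -
  have "\<forall>\<^sub>F n in sequentially. (INF L \<in> S n. ereal (f L n)) < ereal \<delta>"
    by (rule order_tendstoD(2)[OF assms(1)]) (use assms(2) in simp)
  thus ?thesis by eventually_elim (auto simp: INF_less_iff)
qed

text \<open>Every achievable \<open>r\<close> is compared with every feasible \<open>X\<close>, so
  the bound passes to the supremum and the infimum whether or not they are attained.\<close>

lemma E_D_le_E_W:
  assumes \<rho>: "state (a * b) \<rho>"
  shows "E_D a b \<rho> \<le> E_W a b \<rho>"
  unfolding E_D_def E_W_def
proof (intro SUP_least INF_greatest)
  fix r X
  assume "r \<in> {r. 0 \<le> r \<and> (\<lambda>n. distill_error a b \<rho> n (nat \<lfloor>r * real n\<rfloor>)) \<longlonglongrightarrow> 0}"
  hence r: "0 \<le> r" and lim: "(\<lambda>n. distill_error a b \<rho> n (nat \<lfloor>r * real n\<rfloor>)) \<longlonglongrightarrow> 0" by auto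
  assume "X \<in> {X \<in> carrier_mat (a * b) (a * b). hermitian_mat X \<and> loewner_le \<rho> X}"
  hence X: "X \<in> carrier_mat (a * b) (a * b)" "hermitian_mat X" "loewner_le \<rho> X" by auto
  define w where "w = trace_norm (partial_transpose b X)"
  have w: "0 \<le> w"
    unfolding w_def by (rule trace_norm_nonneg[OF partial_transpose_carrier[OF X(1)] partial_transpose_hermitian[OF X(1,2)]])
  have "\<forall>\<^sub>F n in sequentially. \<exists>L \<in> {L. ppt_operation (a ^ n) (b ^ n) (2 ^ nat \<lfloor>r * real n\<rfloor>) (2 ^ nat \<lfloor>r * real n\<rfloor>) L}.
      trace_norm (L (bi_power a b \<rho> n) - bi_power 2 2 bell_state (nat \<lfloor>r * real n\<rfloor>)) < 1 / 2"
    by (rule eventually_INF_less[OF lim[unfolded distill_error_def]]) simp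
  hence "\<forall>\<^sub>F n in sequentially. 1 / 4 \<le> (w * 2 powr (- r)) ^ n"
  proof eventually_elim
    fix n
    define m where "m = nat \<lfloor>r * real n\<rfloor>"
    assume "\<exists>L \<in> {L. ppt_operation (a ^ n) (b ^ n) (2 ^ nat \<lfloor>r * real n\<rfloor>) (2 ^ nat \<lfloor>r * real n\<rfloor>) L}.
      trace_norm (L (bi_power a b \<rho> n) - bi_power 2 2 bell_state (nat \<lfloor>r * real n\<rfloor>)) < 1 / 2"
    then obtain L where L: "ppt_operation (a ^ n) (b ^ n) (2 ^ m) (2 ^ m) L"
      "trace_norm (L (bi_power a b \<rho> n) - bi_power 2 2 bell_state m) < 1 / 2"
      unfolding m_def by blast
    have "1 / 2 \<le> w ^ n * (1 / 2) ^ m"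
      using distillation_bound[OF \<rho> X L(1)] L(2) unfolding w_def by linarith
    moreover have "(1 / 2 :: real) ^ m = 2 powr (- real m)"
      unfolding powr_minus powr_realpow[OF zero_less_numeral] power_one_over inverse_eq_divide ..
    \<comment> \<open>The floor loses less than 1, so 2^(-m) is at most 2 times 2^(-rn); this extra
      2 turns the constant 1/2 into 1/4.\<close>
    moreover have "2 powr (- real m) \<le> 2 powr (1 - r * real n)"
    proof -
      have "r * real n - 1 \<le> real m" unfolding m_def by linarith
      thus ?thesis by (intro powr_mono) auto
    qed
    ultimately have "1 / 2 \<le> w ^ n * 2 powr (1 - r * real n)"
      using w by (smt (verit) mult_left_mono zero_le_power)
    also have "2 powr (1 - r * real n) = 2 * 2 powr (- r * real n)"
      using powr_add[of 2 1 "- r * real n"] by simp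
    also have "2 powr (- r * real n) = (2 powr (- r)) ^ n"
      unfolding powr_realpow[symmetric, OF powr_gt_zero[THEN iffD2, OF zero_neq_numeral[symmetric]]] powr_powr ..
    finally show "1 / 4 \<le> (w * 2 powr (- r)) ^ n" by (simp add: power_mult_distrib)
  qed
  hence "1 \<le> w * 2 powr (- r)" by (rule power_bounded_below_imp_ge_1[rotated 2]) (use w in simp_all)
  hence "2 powr r \<le> w" by (simp add: powr_minus field_simps)
  \<comment> \<open>The value of \<open>log\<close> at 0 is a default, so positivity is established
    before taking logarithms.\<close>
  moreover from this have "0 < w" by (rule less_le_trans[rotated]) simp
  ultimately have "r \<le> log 2 w" by (simp add: le_log_iff)
  thus "ereal r \<le> ereal (log 2 (trace_norm (partial_transpose b X)))" by (simp add: w_def)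
qed

lemma E_eta_le_E_C:
  assumes \<rho>: "state (a * b) \<rho>"
  shows "E_eta a b \<rho> \<le> E_C a b \<rho>"
  unfolding E_eta_def E_C_def
proof (intro SUP_least INF_greatest)
  fix r Y
  assume "r \<in> {r. 0 \<le> r \<and> (\<lambda>n. dilution_error a b \<rho> n (nat \<lfloor>r * real n\<rfloor>)) \<longlonglongrightarrow> 0}"
  hence r: "0 \<le> r" and lim: "(\<lambda>n. dilution_error a b \<rho> n (nat \<lfloor>r * real n\<rfloor>)) \<longlonglongrightarrow> 0" by auto
  assume "Y \<in> {Y \<in> carrier_mat (a * b) (a * b). hermitian_mat Y \<and>
      loewner_le (- Y) (partial_transpose b (support_proj \<rho>)) \<and>
      loewner_le (partial_transpose b (support_proj \<rho>)) Y}"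
  hence Y: "Y \<in> carrier_mat (a * b) (a * b)" "hermitian_mat Y"
      "loewner_le (- Y) (partial_transpose b (support_proj \<rho>))"
      "loewner_le (partial_transpose b (support_proj \<rho>)) Y" by auto
  \<comment> \<open>Trace one excludes dimension zero, where \<open>op_norm\<close> would be
    unspecified.\<close>
  have pos: "0 < a * b"
  proof (rule ccontr)
    assume "\<not> 0 < a * b"
    hence "dim_row \<rho> = 0" using \<rho> by (auto simp: state_def)
    hence "mtrace \<rho> = 0" by (simp add: mtrace_def)
    thus False using \<rho> by (simp add: state_def)
  qed
  define y where "y = op_norm (partial_transpose b Y)"
  have y: "0 \<le> y" unfolding y_def by (rule op_norm_nonneg[OF partial_transpose_carrier[OF Y(1)] pos])
  have "\<forall>\<^sub>F n in sequentially. \<exists>L \<in> {L. ppt_operation (2 ^ nat \<lfloor>r * real n\<rfloor>) (2 ^ nat \<lfloor>r * real n\<rfloor>) (a ^ n) (b ^ n) L}.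
      trace_norm (bi_power a b \<rho> n - L (bi_power 2 2 bell_state (nat \<lfloor>r * real n\<rfloor>))) < 1 / 2"
    by (rule eventually_INF_less[OF lim[unfolded dilution_error_def]]) simp
  hence "\<forall>\<^sub>F n in sequentially. 1 / 2 \<le> (y * 2 powr r) ^ n"
  proof eventually_elim
    fix n
    define m where "m = nat \<lfloor>r * real n\<rfloor>"
    assume "\<exists>L \<in> {L. ppt_operation (2 ^ nat \<lfloor>r * real n\<rfloor>) (2 ^ nat \<lfloor>r * real n\<rfloor>) (a ^ n) (b ^ n) L}.
      trace_norm (bi_power a b \<rho> n - L (bi_power 2 2 bell_state (nat \<lfloor>r * real n\<rfloor>))) < 1 / 2"
    then obtain L where L: "ppt_operation (2 ^ m) (2 ^ m) (a ^ n) (b ^ n) L"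
      "trace_norm (bi_power a b \<rho> n - L (bi_power 2 2 bell_state m)) < 1 / 2"
      unfolding m_def by blast
    have "1 / 2 \<le> y ^ n * 2 ^ m"
      using dilution_bound[OF \<rho> Y L(1)] L(2) unfolding y_def by linarith
    \<comment> \<open>Here rounding down works in favour of the bound, and the constant stays 1/2.
      Nonnegativity of \<open>r\<close> keeps \<open>nat\<close> from truncating a negative floor to
      0.\<close>
    also have "(2 :: real) ^ m \<le> (2 powr r) ^ n"
    proof -
      have "0 \<le> r * real n" using r by simp
      hence "real m \<le> r * real n" unfolding m_def by linarith
      hence "2 powr real m \<le> 2 powr (r * real n)" by (intro powr_mono) auto
      thus ?thesis
        unfolding powr_realpow[OF zero_less_numeral]
          powr_realpow[symmetric, OF powr_gt_zero[THEN iffD2, OF zero_neq_numeral[symmetric]]] powr_powr .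
    qed
    hence "y ^ n * 2 ^ m \<le> y ^ n * (2 powr r) ^ n" using y by (intro mult_left_mono) auto
    finally show "1 / 2 \<le> (y * 2 powr r) ^ n" by (simp add: power_mult_distrib)
  qed
  hence ge: "1 \<le> y * 2 powr r" by (rule power_bounded_below_imp_ge_1[rotated 2]) (use y in simp_all)
  \<comment> \<open>A zero norm would give \<open>log\<close> its default value; the inequality just
    obtained excludes it.\<close>
  have "y \<noteq> 0" using ge by auto
  hence "0 < y" using y by simp
  have "2 powr (- r) \<le> y" using ge by (simp add: powr_minus field_simps)
  hence "- r \<le> log 2 y" using \<open>0 < y\<close> by (simp add: le_log_iff)
  thus "ereal (- log 2 (op_norm (partial_transpose b Y))) \<le> ereal r" by (simp add: y_def)
qed

theorem mainTheorem8:
  fixes a b :: nat and \<rho> :: "complex mat"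
  assumes "state (a * b) \<rho>"
    and "E_W a b \<rho> < E_eta a b \<rho>"
  shows "E_D a b \<rho> < E_C a b \<rho>"
  using E_D_le_E_W[OF assms(1)] assms(2) E_eta_le_E_C[OF assms(1)] by (meson le_less_trans less_le_trans)

end
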